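(* (i) If $\underset{2}{G}{}_{(j)i}^{(b)}$ are the components of a spatial semispray $\underset{2}{G}$ on $E^{*}=J^{1*}(\mathcal{T},M)$, then the local components $$\underset{2}{N}{}_{(j)i}^{(b)}=2\,\underset{2}{G}{}_{(j)i}^{(b)}$$ are the spatial components of a nonlinear connection $N_G$ on $E^{*}$. (ii) Conversely, if $\underset{2}{N}{}_{(j)i}^{(b)}$ are the spatial components of a nonlinear connection $N$ on $E^{*}$, then the local functions $$\underset{2}{G}{}_{(j)i}^{(b)}=\frac12\,\underset{2}{N}{}_{(j)i}^{(b)}$$ are the components of a spatial semispray $\underset{2}{G}{}_N$ on $E^{*}$.
   Context: Everything is $C^\infty$ and repeated indices are summed. $\mathcal{T}$ and $M$ are smooth real manifolds of dimensions $m$ and $n$, with local coordinates $(t^a)_{a=1}^m$ and $(x^i)_{i=1}^n$. $E^{*}=J^{1*}(\mathcal{T},M)\to\mathcal{T}\times M$ is the dual of the first jet vector bundle $J^1(\mathcal{T},M)\to\mathcal{T}\times M$ (whose fibre at $(t,x)$ is the vector space of $1$-jets at $t$ of maps sending $t$ to $x$, with fibre coordinates $x^i_a=\partial x^i/\partial t^a$). It has induced coordinates $(t^a,x^i,p_i^a)$, and coordinate changes on $\mathcal{T}\times M$ of the form $\tilde t^a=\tilde t^a(t^b)$, $\tilde x^i=\tilde x^i(x^j)$ induce on $E^{*}$ the change with $$\tilde p_i^a=\frac{\partial x^j}{\partial\tilde x^i}\frac{\partial\tilde t^a}{\partial t^b}p_j^b .$$ Local functions on $E^{*}$ below are given in every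 such induced chart. Partial derivatives such as $\partial\tilde p_j^b/\partial t^a$, $\partial\tilde p_j^b/\partial x^i$ are taken in the coordinates $(t,x,p)$. A spatial semispray on $E^{*}$ is a global tensor field on $E^{*}$ locally of the form $$\underset{2}{G}=\delta_i^j\,dx^i\otimes\frac{\partial}{\partial x^j}-2\,\underset{2}{G}{}_{(j)i}^{(b)}\,dx^i\otimes\frac{\partial}{\partial p_j^b};$$ the functions $\underset{2}{G}{}_{(j)i}^{(b)}$ are its components. A nonlinear connection on $E^{*}$ is a pair of families of local functions $N=(\underset{1}{N}{}_{(k)a}^{(c)},\underset{2}{N}{}_{(k)i}^{(c)})$ (temporal and spatial components respectively) which transform by $$\underset{1}{\widetilde N}{}_{(j)d}^{(b)}=\underset{1}{N}{}_{(k)a}^{(c)}\frac{\partial\tilde t^b}{\partial t^c}\frac{\partial x^k}{\partial\tilde x^j}\frac{\partial t^a}{\partial\tilde t^d}-\frac{\partial t^a}{\partial\tilde t^d}\frac{\partial\tilde p_j^b}{\partial t^a},\qquad \underset{2}{\widetilde N}{}_{(j)r}^{(b)}=\underset{2}{N}{}_{(k)i}^{(c)}\frac{\partial\tilde t^b}{\partial t^c}\frac{\partial x^k}{\partial\tilde x^j}\frac{\partial x^i}{\partial\tilde x^r}-\frac{\partial x^i}{\partial\tilde x^r}\frac{\partial\tilde p_j^b}{\partial x^i}.$$ A family is said to be the spatial components of a nonlinear connection if it satisfies the second of these rules. *)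

theory Defs
  imports "HOL-Analysis.Analysis"
begin

section \<open>Smooth maps and smooth manifolds\<close>

text \<open>Only used for open sets \<open>S\<close>.\<close>

primrec C_k_on :: "nat \<Rightarrow> 'e::real_normed_vector set \<Rightarrow> ('e \<Rightarrow> 'f::real_normed_vector) \<Rightarrow> bool" where
  "C_k_on 0 S f \<longleftrightarrow> continuous_on S f"
| "C_k_on (Suc k) S f \<longleftrightarrow>
     f differentiable_on S \<and> (\<forall>v. C_k_on k S (\<lambda>x. frechet_derivative f (at x) v))"

definition smooth_on :: "'e::real_normed_vector set \<Rightarrow> ('e \<Rightarrow> 'f::real_normed_vector) \<Rightarrow> bool" where
  "smooth_on S f \<longleftrightarrow> (\<forall>k. C_k_on k S f)"

text \<open>A chart is a domain together with a coordinate map; the values of the map outside the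
  domain are irrelevant.\<close>

type_synonym ('a, 'e) chart = "'a set \<times> ('a \<Rightarrow> 'e)"

abbreviation chart_image :: "('a, 'e) chart \<Rightarrow> 'e set" where
  "chart_image c \<equiv> snd c ` fst c"

definition chart_inv :: "('a, 'e) chart \<Rightarrow> 'e \<Rightarrow> 'a" where
  "chart_inv c = inv_into (fst c) (snd c)"

definition transition :: "('a, 'e) chart \<Rightarrow> ('a, 'e) chart \<Rightarrow> 'e \<Rightarrow> 'e" where
  "transition c d = (\<lambda>y. snd d (chart_inv c y))"

definition is_chart :: "'a topology \<Rightarrow> ('a, 'e::euclidean_space) chart \<Rightarrow> bool" where
  "is_chart X c \<longleftrightarrow> openin X (fst c) \<and> open (chart_image c) \<and>
     homeomorphic_map (subtopology X (fst c)) (top_of_set (chart_image c)) (snd c)"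

definition compatible :: "('a, 'e::euclidean_space) chart \<Rightarrow> ('a, 'e) chart \<Rightarrow> bool" where
  "compatible c d \<longleftrightarrow>
     smooth_on (snd c ` (fst c \<inter> fst d)) (transition c d) \<and>
     smooth_on (snd d ` (fst c \<inter> fst d)) (transition d c)"

definition atlas_carrier :: "('a, 'e) chart set \<Rightarrow> 'a set" where
  "atlas_carrier A = \<Union> (fst ` A)"

text \<open>A manifold comes with its full smooth structure, i.e. with a maximal smooth atlas.\<close>

definition smooth_manifold :: "'a topology \<Rightarrow> ('a, 'e::euclidean_space) chart set \<Rightarrow> bool" where
  "smooth_manifold X A \<longleftrightarrow>
     Hausdorff_space X \<and> second_countable X \<and>
     atlas_carrier A = topspace X \<and>
     (\<forall>c\<in>A. is_chart X c) \<and>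
     (\<forall>c\<in>A. \<forall>d\<in>A. compatible c d) \<and>
     (\<forall>c. is_chart X c \<and> (\<forall>d\<in>A. compatible c d) \<longrightarrow> c \<in> A)"

definition charts_at :: "('a, 'e) chart set \<Rightarrow> 'a \<Rightarrow> ('a, 'e) chart set" where
  "charts_at A q = {c \<in> A. q \<in> fst c}"

text \<open>Derivative of a local real function at \<open>q\<close> in the coordinates \<open>c\<close>, in the direction \<open>u\<close>;
  for \<open>u\<close> a vector of the standard basis this is a partial derivative.\<close>

definition chart_deriv ::
  "('a, 'e::euclidean_space) chart \<Rightarrow> ('a \<Rightarrow> real) \<Rightarrow> 'a \<Rightarrow> 'e \<Rightarrow> real" where
  "chart_deriv c f q u = frechet_derivative (\<lambda>y. f (chart_inv c y)) (at (snd c q)) u"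

definition smooth_in_chart ::
  "('a, 'e::euclidean_space) chart \<Rightarrow> ('a \<Rightarrow> real) \<Rightarrow> bool" where
  "smooth_in_chart c f \<longleftrightarrow> smooth_on (chart_image c) (\<lambda>y. f (chart_inv c y))"


section \<open>Tangent vectors, covectors and (1,1)-tensor fields\<close>

text \<open>Dual of a space of vector-valued families with pointwise linear structure. Functionals are
  extensional, so that they are determined by their values on the space.\<close>

definition dual_space :: "('k \<Rightarrow> 'v::real_vector) set \<Rightarrow> (('k \<Rightarrow> 'v) \<Rightarrow> real) set" where
  "dual_space V = {\<omega> \<in> extensional V.
     \<forall>u\<in>V. \<forall>v\<in>V. \<forall>a b. \<omega> (\<lambda>k. a *\<^sub>R u k + b *\<^sub>R v k) = a * \<omega> u + b * \<omega> v}"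

text \<open>A tangent vector at \<open>q\<close> is the family of its coordinate representations in all charts
  around \<open>q\<close>, related by the differentials of the coordinate changes. Atlases need not be
  maximal here.\<close>

definition tangent_space ::
  "('a, 'e::euclidean_space) chart set \<Rightarrow> 'a \<Rightarrow> (('a, 'e) chart \<Rightarrow> 'e) set" where
  "tangent_space A q = {v.
     (\<forall>c. c \<notin> charts_at A q \<longrightarrow> v c = 0) \<and>
     (\<forall>c\<in>charts_at A q. \<forall>c'\<in>charts_at A q.
        v c' = frechet_derivative (transition c c') (at (snd c q)) (v c))}"

definition cotangent_space ::
  "('a, 'e::euclidean_space) chart set \<Rightarrow> 'a \<Rightarrow> ((('a, 'e) chart \<Rightarrow> 'e) \<Rightarrow> real) set" where
  "cotangent_space A q = dual_space (tangent_space A q)"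

text \<open>For \<open>u\<close> a vector of the standard basis, the following are the coordinate tangent vector and
  the coordinate differential at \<open>q\<close> belonging to the corresponding coordinate of \<open>c\<close>.\<close>

definition coord_vector ::
  "('a, 'e::euclidean_space) chart set \<Rightarrow> ('a, 'e) chart \<Rightarrow> 'a \<Rightarrow> 'e \<Rightarrow> (('a, 'e) chart \<Rightarrow> 'e)" where
  "coord_vector A c q u =
     (\<lambda>c'. if c' \<in> charts_at A q
           then frechet_derivative (transition c c') (at (snd c q)) u else 0)"

definition coord_covector ::
  "('a, 'e::euclidean_space) chart set \<Rightarrow> ('a, 'e) chart \<Rightarrow> 'a \<Rightarrow> 'e
    \<Rightarrow> ((('a, 'e) chart \<Rightarrow> 'e) \<Rightarrow> real)" where
  "coord_covector A c q u = restrict (\<lambda>v. v c \<bullet> u) (tangent_space A q)"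

text \<open>A tensor of type (1,1) at \<open>q\<close> is a bilinear form on pairs of a tangent vector and a
  covector; \<open>\<alpha> \<otimes> X\<close> is the form \<open>(v, \<omega>) \<mapsto> \<alpha>(v) \<omega>(X)\<close>.\<close>

type_synonym ('a, 'e) tensor_field =
  "'a \<Rightarrow> (('a, 'e) chart \<Rightarrow> 'e) \<Rightarrow> ((('a, 'e) chart \<Rightarrow> 'e) \<Rightarrow> real) \<Rightarrow> real"

definition tensor_prod ::
  "('v \<Rightarrow> real) \<Rightarrow> 'v \<Rightarrow> 'v \<Rightarrow> ('v \<Rightarrow> real) \<Rightarrow> real" where
  "tensor_prod \<alpha> X = (\<lambda>v \<omega>. \<alpha> v * \<omega> X)"

definition smooth_tensor_field ::
  "('a, 'e::euclidean_space) chart set \<Rightarrow> ('a, 'e) tensor_field \<Rightarrow> bool" where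
  "smooth_tensor_field A G \<longleftrightarrow>
     (\<forall>q\<in>atlas_carrier A.
        (\<forall>\<omega>\<in>cotangent_space A q. \<forall>u\<in>tangent_space A q. \<forall>v\<in>tangent_space A q. \<forall>a b.
           G q (\<lambda>c. a *\<^sub>R u c + b *\<^sub>R v c) \<omega> = a * G q u \<omega> + b * G q v \<omega>) \<and>
        (\<forall>v\<in>tangent_space A q. \<forall>\<omega>\<in>cotangent_space A q. \<forall>\<eta>\<in>cotangent_space A q. \<forall>a b.
           G q v (restrict (\<lambda>u. a * \<omega> u + b * \<eta> u) (tangent_space A q))
             = a * G q v \<omega> + b * G q v \<eta>)) \<and>
     (\<forall>c\<in>A. \<forall>u\<in>Basis. \<forall>w\<in>Basis.
        smooth_in_chart c (\<lambda>q. G q (coord_vector A c q u) (coord_covector A c q w)))"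


section \<open>The dual of the first jet bundle\<close>

definition smooth_near ::
  "('a, 'e::euclidean_space) chart set \<Rightarrow> ('b, 'f::euclidean_space) chart set
    \<Rightarrow> 'a \<Rightarrow> ('a \<Rightarrow> 'b) \<Rightarrow> bool" where
  "smooth_near A B t f \<longleftrightarrow>
     (\<exists>c\<in>charts_at A t. \<exists>d\<in>charts_at B (f t). \<exists>W.
        open W \<and> snd c t \<in> W \<and> W \<subseteq> chart_image c \<and>
        (\<forall>y\<in>W. f (chart_inv c y) \<in> fst d) \<and>
        smooth_on W (\<lambda>y. snd d (f (chart_inv c y))))"

text \<open>Two maps sending \<open>t\<close> to \<open>x\<close> have the same 1-jet at \<open>t\<close> iff their first partial derivatives
  at \<open>t\<close> agree in all charts. The 1-jet is therefore represented by the family of these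
  derivatives \<open>x\<^sup>i\<^sub>a = \<partial>x\<^sup>i/\<partial>t\<^sup>a\<close>, stored as the entry \<open>$ i $ a\<close>; in this form the linear
  operations on the fibres of the jet bundle are pointwise.\<close>

type_synonym ('a, 'b, 'm, 'n) jet =
  "('a, real^'m) chart \<times> ('b, real^'n) chart \<Rightarrow> real^'m^'n"

definition jet_of ::
  "('a, real^'m) chart set \<Rightarrow> ('b, real^'n) chart set \<Rightarrow> 'a \<Rightarrow> ('a \<Rightarrow> 'b)
    \<Rightarrow> ('a, 'b, 'm::finite, 'n::finite) jet" where
  "jet_of A B t f =
     (\<lambda>(c, d). if c \<in> charts_at A t \<and> d \<in> charts_at B (f t)
               then jacobian (\<lambda>y. snd d (f (chart_inv c y))) (at (snd c t)) else 0)"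

definition jet_fibre ::
  "('a, real^'m) chart set \<Rightarrow> ('b, real^'n) chart set \<Rightarrow> 'a \<Rightarrow> 'b
    \<Rightarrow> ('a, 'b, 'm::finite, 'n::finite) jet set" where
  "jet_fibre A B t x = {jet_of A B t f | f. smooth_near A B t f \<and> f t = x}"

type_synonym ('a, 'b, 'm, 'n) dual_jet = "'a \<times> 'b \<times> (('a, 'b, 'm, 'n) jet \<Rightarrow> real)"

definition dual_jet_bundle ::
  "('a, real^'m) chart set \<Rightarrow> ('b, real^'n) chart set
    \<Rightarrow> ('a, 'b, 'm::finite, 'n::finite) dual_jet set" where
  "dual_jet_bundle A B =
     {(t, x, \<omega>). t \<in> atlas_carrier A \<and> x \<in> atlas_carrier B \<and> \<omega> \<in> dual_space (jet_fibre A B t x)}"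

text \<open>The coordinates \<open>p\<^sub>i\<^sup>a\<close> (stored as \<open>$ i $ a\<close>) of a functional on the fibre of jets: those dual
  to the coordinates \<open>x\<^sup>i\<^sub>a\<close> of jets.\<close>

definition momentum ::
  "('a, real^'m) chart set \<Rightarrow> ('b, real^'n) chart set \<Rightarrow> ('a, real^'m) chart \<Rightarrow> ('b, real^'n) chart
    \<Rightarrow> ('a, 'b, 'm::finite, 'n::finite) dual_jet \<Rightarrow> real^'m^'n" where
  "momentum A B c d = (\<lambda>(t, x, \<omega>).
     THE p. \<forall>j\<in>jet_fibre A B t x. \<omega> j = (\<Sum>i\<in>UNIV. \<Sum>a\<in>UNIV. p $ i $ a * j (c, d) $ i $ a))"

type_synonym ('m, 'n) dual_jet_coords = "(real^'m) \<times> (real^'n) \<times> (real^'m^'n)"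

definition induced_chart ::
  "('a, real^'m) chart set \<Rightarrow> ('b, real^'n) chart set \<Rightarrow> ('a, real^'m) chart \<Rightarrow> ('b, real^'n) chart
    \<Rightarrow> (('a, 'b, 'm::finite, 'n::finite) dual_jet, ('m, 'n) dual_jet_coords) chart" where
  "induced_chart A B c d =
     ({(t, x, \<omega>) \<in> dual_jet_bundle A B. t \<in> fst c \<and> x \<in> fst d},
      \<lambda>(t, x, \<omega>). (snd c t, snd d x, momentum A B c d (t, x, \<omega>)))"

definition induced_atlas ::
  "('a, real^'m) chart set \<Rightarrow> ('b, real^'n) chart set
    \<Rightarrow> (('a, 'b, 'm::finite, 'n::finite) dual_jet, ('m, 'n) dual_jet_coords) chart set" where
  "induced_atlas A B = {induced_chart A B c d | c d. c \<in> A \<and> d \<in> B}"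

abbreviation t_dir :: "'m::finite \<Rightarrow> ('m, 'n::finite) dual_jet_coords" where
  "t_dir a \<equiv> (axis a 1, 0, 0)"

abbreviation x_dir :: "'n::finite \<Rightarrow> ('m::finite, 'n) dual_jet_coords" where
  "x_dir i \<equiv> (0, axis i 1, 0)"

abbreviation p_dir :: "'n::finite \<Rightarrow> 'm::finite \<Rightarrow> ('m, 'n) dual_jet_coords" where
  "p_dir j b \<equiv> (0, 0, axis j (axis b 1))"


section \<open>Spatial semisprays and nonlinear connections\<close>

text \<open>Families of local functions on the dual jet bundle, one for each pair of charts of the two
  base manifolds; only the values on the domain of the induced chart matter. The last three
  arguments are the indices, so \<open>G c d e j i b\<close> stands for \<open>G\<close> with indices \<open>(j)\<close>, \<open>i\<close>, \<open>(b)\<close>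
  and \<open>N c d e k a b\<close> for \<open>N\<close> with indices \<open>(k)\<close>, \<open>a\<close>, \<open>(b)\<close>.\<close>

type_synonym ('a, 'b, 'm, 'n) spatial_family =
  "('a, real^'m) chart \<Rightarrow> ('b, real^'n) chart \<Rightarrow> ('a, 'b, 'm, 'n) dual_jet
    \<Rightarrow> 'n \<Rightarrow> 'n \<Rightarrow> 'm \<Rightarrow> real"

type_synonym ('a, 'b, 'm, 'n) temporal_family =
  "('a, real^'m) chart \<Rightarrow> ('b, real^'n) chart \<Rightarrow> ('a, 'b, 'm, 'n) dual_jet
    \<Rightarrow> 'n \<Rightarrow> 'm \<Rightarrow> 'm \<Rightarrow> real"

definition spatial_semispray ::
  "('a, real^'m) chart set \<Rightarrow> ('b, real^'n) chart set
    \<Rightarrow> (('a, 'b, 'm::finite, 'n::finite) dual_jet, ('m, 'n) dual_jet_coords) tensor_field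
    \<Rightarrow> ('a, 'b, 'm, 'n) spatial_family \<Rightarrow> bool" where
  "spatial_semispray A B G Gc \<longleftrightarrow>
     smooth_tensor_field (induced_atlas A B) G \<and>
     (\<forall>c\<in>A. \<forall>d\<in>B. \<forall>e\<in>fst (induced_chart A B c d).
        \<forall>v\<in>tangent_space (induced_atlas A B) e. \<forall>\<omega>\<in>cotangent_space (induced_atlas A B) e.
          let dx = (\<lambda>i. coord_covector (induced_atlas A B) (induced_chart A B c d) e (x_dir i));
              del_x = (\<lambda>j. coord_vector (induced_atlas A B) (induced_chart A B c d) e (x_dir j));
              del_p = (\<lambda>j b. coord_vector (induced_atlas A B) (induced_chart A B c d) e (p_dir j b))
          in G e v \<omega> =
               (\<Sum>i\<in>UNIV. \<Sum>j\<in>UNIV. (if i = j then 1 else 0) * tensor_prod (dx i) (del_x j) v \<omega>)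
               - 2 * (\<Sum>i\<in>UNIV. \<Sum>j\<in>UNIV. \<Sum>b\<in>UNIV.
                        Gc c d e j i b * tensor_prod (dx i) (del_p j b) v \<omega>))"

text \<open>The entry \<open>coord_change c c' q $ b $ a\<close> is the derivative of the \<open>b\<close>-th coordinate of \<open>c'\<close> with
  respect to the \<open>a\<close>-th coordinate of \<open>c\<close>.\<close>

definition coord_change ::
  "('a, real^'m::finite) chart \<Rightarrow> ('a, real^'m) chart \<Rightarrow> 'a \<Rightarrow> real^'m^'m" where
  "coord_change c c' q = jacobian (transition c c') (at (snd c q))"

definition temporal_connection ::
  "('a, real^'m) chart set \<Rightarrow> ('b, real^'n) chart set
    \<Rightarrow> ('a, 'b, 'm::finite, 'n::finite) temporal_family \<Rightarrow> bool" where
  "temporal_connection A B N \<longleftrightarrow>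
     (\<forall>c\<in>A. \<forall>d\<in>B. \<forall>k a r. smooth_in_chart (induced_chart A B c d) (\<lambda>e. N c d e k a r)) \<and>
     (\<forall>c\<in>A. \<forall>d\<in>B. \<forall>c'\<in>A. \<forall>d'\<in>B.
      \<forall>(t, x, \<omega>) \<in> fst (induced_chart A B c d) \<inter> fst (induced_chart A B c' d'). \<forall>j s b.
        N c' d' (t, x, \<omega>) j s b =
          (\<Sum>k\<in>UNIV. \<Sum>a\<in>UNIV. \<Sum>r\<in>UNIV. N c d (t, x, \<omega>) k a r *
             coord_change c c' t $ b $ r * coord_change d' d x $ k $ j * coord_change c' c t $ a $ s)
          - (\<Sum>a\<in>UNIV. coord_change c' c t $ a $ s *
               chart_deriv (induced_chart A B c d) (\<lambda>e. momentum A B c' d' e $ j $ b)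
                 (t, x, \<omega>) (t_dir a)))"

definition spatial_connection ::
  "('a, real^'m) chart set \<Rightarrow> ('b, real^'n) chart set
    \<Rightarrow> ('a, 'b, 'm::finite, 'n::finite) spatial_family \<Rightarrow> bool" where
  "spatial_connection A B N \<longleftrightarrow>
     (\<forall>c\<in>A. \<forall>d\<in>B. \<forall>k i r. smooth_in_chart (induced_chart A B c d) (\<lambda>e. N c d e k i r)) \<and>
     (\<forall>c\<in>A. \<forall>d\<in>B. \<forall>c'\<in>A. \<forall>d'\<in>B.
      \<forall>(t, x, \<omega>) \<in> fst (induced_chart A B c d) \<inter> fst (induced_chart A B c' d'). \<forall>j s b.
        N c' d' (t, x, \<omega>) j s b =
          (\<Sum>k\<in>UNIV. \<Sum>i\<in>UNIV. \<Sum>r\<in>UNIV. N c d (t, x, \<omega>) k i r *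
             coord_change c c' t $ b $ r * coord_change d' d x $ k $ j * coord_change d' d x $ i $ s)
          - (\<Sum>i\<in>UNIV. coord_change d' d x $ i $ s *
               chart_deriv (induced_chart A B c d) (\<lambda>e. momentum A B c' d' e $ j $ b)
                 (t, x, \<omega>) (x_dir i)))"

text \<open>A family is called the spatial components of a nonlinear connection as soon as it satisfies
  \<open>spatial_connection\<close>, without reference to temporal components.\<close>

definition nonlinear_connection ::
  "('a, real^'m) chart set \<Rightarrow> ('b, real^'n) chart set
    \<Rightarrow> ('a, 'b, 'm::finite, 'n::finite) temporal_family
    \<Rightarrow> ('a, 'b, 'm, 'n) spatial_family \<Rightarrow> bool" where
  "nonlinear_connection A B N1 N2 \<longleftrightarrow> temporal_connection A B N1 \<and> spatial_connection A B N2"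

end

theory Submission
  imports Defs
begin

text \<open>Both statements express that a spatial semispray and the spatial part of a nonlinear
  connection are the same geometric object: an endomorphism of the tangent bundle of the dual jet
  bundle. In an induced chart let \<open>horizontal N\<close> be the endomorphism
  \<open>(\<tau>, \<xi>, \<pi>) \<mapsto> (0, \<xi>, - N \<xi>)\<close>, where \<open>N \<xi>\<close> contracts the index \<open>i\<close> of \<open>N\<^bsub>(j)i\<^esub>\<^bsup>(b)\<^esup>\<close> with \<open>\<xi>\<close>.

  On the one hand, the local expression of a semispray with components \<open>G\<close> is the tensor of
  \<open>horizontal (2 G)\<close> (\<open>spatial_semispray_iff\<close>). On the other hand, let \<open>F\<close> be the differential of a
  change of induced charts. It is block triangular: it acts on \<open>\<tau>\<close> and \<open>\<xi>\<close> by the Jacobians of the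
  base coordinate changes and on \<open>\<pi>\<close> by their dual action, and its mixed block from \<open>\<xi>\<close> to \<open>\<pi>\<close>
  consists of the derivatives \<open>\<partial>p'/\<partial>x\<close>, the inhomogeneous term of the transformation law. Comparing
  blocks, that law holds iff \<open>F \<circ> horizontal N = horizontal N' \<circ> F\<close>
  (\<open>intertwining_iff_transformation_law\<close>, \<open>spatial_connection_iff_intertwining\<close>). This relation is the
  condition for the local endomorphisms to fit together to a global tensor, so the
  two notions correspond under \<open>N = 2 G\<close>.

  What has to be supplied is the differential \<open>F\<close>. A jet may have any matrix as its coordinates, so
  jet fibres are vector spaces, the momentum coordinates exist, and they transform dually to jets
  (\<open>jet_of_matrix_in_jet_fibre\<close>, \<open>dual_jet_eq_momentum\<close>, \<open>momentum_change_of_charts\<close>). The resulting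
  formula for the transitions of the induced charts can be differentiated because the base
  transitions are twice differentiable (\<open>has_derivative_transition_induced_chart\<close>).\<close>

section \<open>Smooth functions on open sets\<close>

lemma has_derivative_cong_nhds:
  assumes "(f has_derivative D) (at x)" "eventually (\<lambda>y. f y = g y) (nhds x)"
  shows "(g has_derivative D) (at x)"
  using has_derivative_transform_eventually[OF assms(1), of g]
    eventually_nhds_x_imp_x[OF assms(2)] assms(2)
  by (auto simp: eventually_nhds_conv_at)

lemma C_k_on_cong:
  assumes "open S" "\<And>x. x \<in> S \<Longrightarrow> f x = g x" "C_k_on k S f"
  shows "C_k_on k S g"
  using assms
proof (induction k arbitrary: f g)
  case 0
  then show ?case by (simp cong: continuous_on_cong)
next
  case (Suc k)
  have eq: "frechet_derivative f (at x) = frechet_derivative g (at x)" if "x \<in> S" for x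
  proof -
    have "eventually (\<lambda>y. f y = g y) (nhds x)"
      using Suc.prems(1,2) that by (auto simp: eventually_nhds)
    then have "(f has_derivative D) (at x) \<longleftrightarrow> (g has_derivative D) (at x)" for D
      using has_derivative_cong_nhds[of f D x g] has_derivative_cong_nhds[of g D x f]
      by (auto simp: eq_commute)
    then show ?thesis by (simp add: frechet_derivative_def)
  qed
  have "g differentiable_on S"
    using Suc.prems has_derivative_transform[of _ S g f]
    unfolding C_k_on.simps differentiable_on_def differentiable_def by metis
  moreover have "C_k_on k S (\<lambda>x. frechet_derivative g (at x) v)" for v
    by (rule Suc.IH[OF \<open>open S\<close>, of "\<lambda>x. frechet_derivative f (at x) v"])
       (use eq Suc.prems(3) in auto)
  ultimately show ?case by simp
qed

lemma C_k_on_const: "C_k_on k S (\<lambda>x. a)"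
  by (induction k arbitrary: a) simp_all

lemma C_k_on_lincomb:
  assumes "open S" "C_k_on k S f" "C_k_on k S g"
  shows "C_k_on k S (\<lambda>x. a *\<^sub>R f x + b *\<^sub>R g x)"
  using assms
proof (induction k arbitrary: f g)
  case 0
  then show ?case by (simp add: continuous_on_add continuous_on_scaleR)
next
  case (Suc k)
  have d: "f differentiable at x" "g differentiable at x" if "x \<in> S" for x
    using Suc.prems that differentiable_on_eq_differentiable_at[OF \<open>open S\<close>]
    unfolding C_k_on.simps by blast+
  have fd: "frechet_derivative (\<lambda>x. a *\<^sub>R f x + b *\<^sub>R g x) (at x)
      = (\<lambda>v. a *\<^sub>R frechet_derivative f (at x) v + b *\<^sub>R frechet_derivative g (at x) v)"
    if "x \<in> S" for x
    by (rule frechet_derivative_at[symmetric])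
       (intro has_derivative_add has_derivative_scaleR_right
          frechet_derivative_works[THEN iffD1] d[OF that])
  have "(\<lambda>x. a *\<^sub>R f x + b *\<^sub>R g x) differentiable_on S"
    using Suc.prems by (simp add: differentiable_on_add differentiable_on_scaleR)
  moreover have "C_k_on k S (\<lambda>x. frechet_derivative (\<lambda>x. a *\<^sub>R f x + b *\<^sub>R g x) (at x) v)" for v
    by (rule C_k_on_cong[OF \<open>open S\<close> _ Suc.IH[OF \<open>open S\<close>,
          of "\<lambda>x. frechet_derivative f (at x) v" "\<lambda>x. frechet_derivative g (at x) v"]])
       (use fd Suc.prems in auto)
  ultimately show ?case by simp
qed

lemma smooth_on_cong:
  assumes "open S" "\<And>x. x \<in> S \<Longrightarrow> f x = g x"
  shows "smooth_on S f \<longleftrightarrow> smooth_on S g"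
  unfolding smooth_on_def using assms C_k_on_cong[of S f g] C_k_on_cong[of S g f] by auto

lemma smooth_on_const: "smooth_on S (\<lambda>x. a)"
  by (simp add: smooth_on_def C_k_on_const)

lemma smooth_on_add:
  assumes "open S" "smooth_on S f" "smooth_on S g"
  shows "smooth_on S (\<lambda>x. f x + g x)"
  using C_k_on_lincomb[OF assms(1), of _ f g 1 1] assms by (simp add: smooth_on_def)

lemma smooth_on_scaleR:
  assumes "open S" "smooth_on S f"
  shows "smooth_on S (\<lambda>x. b *\<^sub>R f x)"
  using C_k_on_lincomb[OF assms(1), of _ f f b 0] assms by (simp add: smooth_on_def)

lemma smooth_on_sum:
  assumes "open S" "finite I" "\<And>i. i \<in> I \<Longrightarrow> smooth_on S (f i)"
  shows "smooth_on S (\<lambda>x. \<Sum>i\<in>I. f i x)"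
  using assms(2,3)
proof (induction I rule: finite_induct)
  case (insert i I)
  then show ?case
    using smooth_on_add[OF assms(1), of "f i" "\<lambda>x. \<Sum>i\<in>I. f i x"] by simp
qed (simp add: smooth_on_const)

lemma smooth_on_affine:
  fixes L :: "'e::real_normed_vector \<Rightarrow> 'f::real_normed_vector"
  assumes "bounded_linear L"
  shows "smooth_on S (\<lambda>y. z + L (y - y0))"
proof -
  have d: "((\<lambda>y. z + L (y - y0)) has_derivative L) (at x)" for x
    by (auto intro!: derivative_eq_intros bounded_linear.has_derivative[OF assms])
  have fd: "frechet_derivative (\<lambda>y. z + L (y - y0)) (at x) = L" for x
    using frechet_derivative_at[OF d] by simp
  have diff: "(\<lambda>y. z + L (y - y0)) differentiable_on S"
    using d has_derivative_at_withinI unfolding differentiable_on_def differentiable_def by blast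
  have "C_k_on k S (\<lambda>y. z + L (y - y0))" for k
    by (cases k) (simp_all add: fd C_k_on_const diff differentiable_imp_continuous_on)
  then show ?thesis by (simp add: smooth_on_def)
qed

lemma smooth_on_differentiable_at:
  assumes "smooth_on S f" "open S" "x \<in> S"
  shows "f differentiable at x"
    and "(\<lambda>y. frechet_derivative f (at y) v) differentiable at x"
proof -
  have "C_k_on (Suc (Suc 0)) S f"
    using assms(1) unfolding smooth_on_def by blast
  then show "f differentiable at x" "(\<lambda>y. frechet_derivative f (at y) v) differentiable at x"
    using assms(3) differentiable_on_eq_differentiable_at[OF assms(2)]
    unfolding C_k_on.simps by blast+
qed

section \<open>Tangent vectors for an atlas with differentiable transitions\<close>

text \<open>Chart-wise tangent vectors make sense as soon as the transition maps can be differentiated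
  once: the only facts behind their calculus are the chain rule, which gives the cocycle identity
  for the differentials \<open>D\<close>, and \<open>D c c q = id\<close>. Stating this for a weak notion of atlas
  pays off for the dual jet bundle, whose transition maps contain first derivatives of the
  transition maps of the base: their differentiability is a statement about two derivatives of the
  latter.\<close>

locale differentiable_atlas =
  fixes S :: "('a, 'e::euclidean_space) chart set"
  assumes inj_chart: "c \<in> S \<Longrightarrow> inj_on (snd c) (fst c)"
    and open_overlap: "c \<in> S \<Longrightarrow> d \<in> S \<Longrightarrow> open (snd c ` (fst c \<inter> fst d))"
    and transition_differentiable:
      "c \<in> S \<Longrightarrow> d \<in> S \<Longrightarrow> q \<in> fst c \<Longrightarrow> q \<in> fst d \<Longrightarrow> transition c d differentiable at (snd c q)"
begin

abbreviation D :: "('a, 'e) chart \<Rightarrow> ('a, 'e) chart \<Rightarrow> 'a \<Rightarrow> 'e \<Rightarrow> 'e" where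
  "D c c' q \<equiv> frechet_derivative (transition c c') (at (snd c q))"

lemma chart_inv_chart [simp]: "c \<in> S \<Longrightarrow> q \<in> fst c \<Longrightarrow> chart_inv c (snd c q) = q"
  by (simp add: chart_inv_def inj_chart)

lemma eventually_overlap:
  assumes "c \<in> S" "d \<in> S" "q \<in> fst c" "q \<in> fst d"
  shows "eventually (\<lambda>y. chart_inv c y \<in> fst c \<and> chart_inv c y \<in> fst d \<and> snd c (chart_inv c y) = y)
    (nhds (snd c q))"
  using assms open_overlap[OF assms(1,2)]
  unfolding eventually_nhds by (intro exI[of _ "snd c ` (fst c \<inter> fst d)"]) auto

lemma has_derivative_transition:
  assumes "c \<in> charts_at S q" "c' \<in> charts_at S q"
  shows "(transition c c' has_derivative D c c' q) (at (snd c q))"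
  using assms transition_differentiable by (auto simp: charts_at_def frechet_derivative_works)

lemma linear_D:
  assumes "c \<in> charts_at S q" "c' \<in> charts_at S q"
  shows "linear (D c c' q)"
  using has_derivative_transition[OF assms] by (rule has_derivative_linear)

lemma D_self:
  assumes "c \<in> charts_at S q"
  shows "D c c q u = u"
proof -
  have c: "c \<in> S" "q \<in> fst c" using assms by (auto simp: charts_at_def)
  have ev: "eventually (\<lambda>y. id y = transition c c y) (nhds (snd c q))"
    using eventually_overlap[OF c(1,1) c(2,2)] by eventually_elim (auto simp: transition_def)
  have "(id has_derivative (\<lambda>u. u)) (at (snd c q))"
    by (simp add: id_def)
  then have "(transition c c has_derivative (\<lambda>u. u)) (at (snd c q))"
    using ev by (rule has_derivative_cong_nhds)
  then show ?thesis
    by (metis frechet_derivative_at)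
qed

text \<open>The domains of three charts overlap in a neighbourhood of \<open>q\<close>, where the transition
  from the first to the third factors through the second; the chain rule does the rest.\<close>

lemma D_cocycle:
  assumes "c \<in> charts_at S q" "c' \<in> charts_at S q" "c'' \<in> charts_at S q"
  shows "D c' c'' q (D c c' q u) = D c c'' q u"
proof -
  have c: "c \<in> S" "q \<in> fst c" "c' \<in> S" "q \<in> fst c'" "c'' \<in> S" "q \<in> fst c''"
    using assms by (auto simp: charts_at_def)
  have ev: "eventually (\<lambda>y. (transition c' c'' \<circ> transition c c') y = transition c c'' y)
    (nhds (snd c q))"
    using eventually_overlap[OF c(1,3) c(2,4)]
    by eventually_elim (use c in \<open>auto simp: transition_def\<close>)
  have "transition c c' (snd c q) = snd c' q" using c by (simp add: transition_def)
  then have "(transition c' c'' \<circ> transition c c' has_derivative D c' c'' q \<circ> D c c' q) (at (snd c q))"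
    using has_derivative_transition[OF assms(1,2)] has_derivative_transition[OF assms(2,3)]
    by (intro diff_chain_at) auto
  then have "(transition c c'' has_derivative D c' c'' q \<circ> D c c' q) (at (snd c q))"
    using ev by (rule has_derivative_cong_nhds)
  then show ?thesis
    by (metis frechet_derivative_at comp_apply)
qed

lemma coord_vector_chart:
  "c' \<in> charts_at S q \<Longrightarrow> coord_vector S c q u c' = D c c' q u"
  by (simp add: coord_vector_def)

lemma coord_vector_in_tangent_space:
  assumes "c \<in> charts_at S q"
  shows "coord_vector S c q u \<in> tangent_space S q"
  using assms D_cocycle by (auto simp: tangent_space_def coord_vector_def)

lemma coord_vector_lincomb:
  assumes "c \<in> charts_at S q"
  shows "coord_vector S c q (a *\<^sub>R u + b *\<^sub>R v)
    = (\<lambda>k. a *\<^sub>R coord_vector S c q u k + b *\<^sub>R coord_vector S c q v k)"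
  using linear_D[OF assms] by (auto simp: coord_vector_def linear_add linear_scale)

text \<open>Together with \<open>coord_vector_in_tangent_space\<close>: the evaluation \<open>v \<mapsto> v c\<close> identifies the
  tangent space with the model space, with inverse \<open>coord_vector S c q\<close>.\<close>

lemma coord_vector_eq:
  assumes "c \<in> charts_at S q" "v \<in> tangent_space S q"
  shows "coord_vector S c q (v c) = v"
proof
  fix c'
  have "c' \<notin> charts_at S q \<Longrightarrow> v c' = 0"
    using assms(2) unfolding tangent_space_def by blast
  moreover have "c' \<in> charts_at S q \<Longrightarrow> v c' = D c c' q (v c)"
    using assms unfolding tangent_space_def by blast
  ultimately have "v c' = (if c' \<in> charts_at S q then D c c' q (v c) else 0)"
    by presburger
  then show "coord_vector S c q (v c) c' = v c'"
    by (simp only: coord_vector_def)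
qed

lemma coord_vector_change:
  assumes "c \<in> charts_at S q" "c' \<in> charts_at S q"
  shows "coord_vector S c' q (D c c' q u) = coord_vector S c q u"
  using coord_vector_eq[OF assms(2) coord_vector_in_tangent_space[OF assms(1)], of u]
  by (simp add: coord_vector_chart[OF assms(2)])

lemma tangent_space_lincomb:
  assumes "u \<in> tangent_space S q" "v \<in> tangent_space S q"
  shows "(\<lambda>k. a *\<^sub>R u k + b *\<^sub>R v k) \<in> tangent_space S q"
  unfolding tangent_space_def
proof (intro CollectI conjI ballI allI impI)
  fix c c' assume c: "c \<in> charts_at S q" "c' \<in> charts_at S q"
  have "u c' = D c c' q (u c)" "v c' = D c c' q (v c)"
    using c assms unfolding tangent_space_def by blast+
  then show "a *\<^sub>R u c' + b *\<^sub>R v c' = D c c' q (a *\<^sub>R u c + b *\<^sub>R v c)"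
    using linear_D[OF c] by (simp add: linear_add linear_scale)
next
  fix c assume c: "c \<notin> charts_at S q"
  have "u c = 0" "v c = 0"
    using c assms unfolding tangent_space_def by blast+
  then show "a *\<^sub>R u c + b *\<^sub>R v c = 0" by simp
qed

lemma coord_covector_in_cotangent_space:
  "coord_covector S c q w \<in> cotangent_space S q"
  by (auto simp: coord_covector_def cotangent_space_def dual_space_def tangent_space_lincomb
      inner_add_left)

lemma coord_covector_coord_vector:
  assumes "c \<in> charts_at S q" "c' \<in> charts_at S q"
  shows "coord_covector S c' q w (coord_vector S c q u) = D c c' q u \<bullet> w"
  using coord_vector_in_tangent_space[OF assms(1)]
  by (simp add: coord_covector_def coord_vector_chart[OF assms(2)])

lemma linear_covector_coords:
  assumes "c \<in> charts_at S q" "\<omega> \<in> cotangent_space S q"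
  shows "linear (\<lambda>u. \<omega> (coord_vector S c q u))"
proof -
  have *: "\<omega> (coord_vector S c q (a *\<^sub>R u + b *\<^sub>R v))
    = a * \<omega> (coord_vector S c q u) + b * \<omega> (coord_vector S c q v)" for a b u v
    using assms(2) coord_vector_in_tangent_space[OF assms(1)]
    unfolding coord_vector_lincomb[OF assms(1)] cotangent_space_def dual_space_def by blast
  show ?thesis
    using *[of 1 _ 1] *[of _ _ 0] by (intro linearI) auto
qed

end

section \<open>Manifolds as differentiable atlases\<close>

text \<open>For the inner product that sums over all entries, multiplication by a matrix has
  multiplication by its transpose as adjoint. This moves a change of charts from jets to the
  momenta paired with them.\<close>

lemma inner_matrix_matrix_mult_left:
  fixes P :: "real^'k^'n" and Q :: "real^'m^'k" and X :: "real^'m^'n"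
  shows "(P ** Q) \<bullet> X = Q \<bullet> (transpose P ** X)"
proof -
  have "(P ** Q) \<bullet> X = (\<Sum>i\<in>UNIV. \<Sum>a\<in>UNIV. \<Sum>k\<in>UNIV. P $ i $ k * Q $ k $ a * X $ i $ a)"
    by (simp add: inner_vec_def matrix_matrix_mult_def sum_distrib_right)
  also have "\<dots> = (\<Sum>i\<in>UNIV. \<Sum>k\<in>UNIV. \<Sum>a\<in>UNIV. P $ i $ k * Q $ k $ a * X $ i $ a)"
    by (intro sum.cong refl sum.swap)
  also have "\<dots> = (\<Sum>k\<in>UNIV. \<Sum>i\<in>UNIV. \<Sum>a\<in>UNIV. P $ i $ k * Q $ k $ a * X $ i $ a)"
    by (rule sum.swap)
  also have "\<dots> = (\<Sum>k\<in>UNIV. \<Sum>a\<in>UNIV. \<Sum>i\<in>UNIV. P $ i $ k * Q $ k $ a * X $ i $ a)"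
    by (intro sum.cong refl sum.swap)
  also have "\<dots> = Q \<bullet> (transpose P ** X)"
    by (simp add: inner_vec_def matrix_matrix_mult_def sum_distrib_left transpose_def algebra_simps)
  finally show ?thesis .
qed

lemma inner_transpose: "transpose P \<bullet> transpose Q = P \<bullet> (Q :: real^'m^'n)"
  by (simp add: inner_vec_def transpose_def) (rule sum.swap)

lemma inner_matrix_matrix_mult_right:
  fixes P :: "real^'k^'n" and Q :: "real^'m^'k" and X :: "real^'m^'n"
  shows "(P ** Q) \<bullet> X = P \<bullet> (X ** transpose Q)"
  using inner_matrix_matrix_mult_left[of "transpose Q" "transpose P" "transpose X"]
  by (simp add: inner_transpose flip: matrix_transpose_mul)
     (metis inner_transpose matrix_transpose_mul transpose_transpose)

lemma matrix_sandwich_lincomb: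
  fixes P Q :: "real^'m^'n"
  shows "J ** (a *\<^sub>R P + b *\<^sub>R Q) ** C = a *\<^sub>R (J ** P ** C) + b *\<^sub>R (J ** Q ** C)"
  by (simp add: vec_eq_iff matrix_matrix_mult_def sum_distrib_left sum_distrib_right
      sum.distrib algebra_simps)

lemma smooth_manifold_imp_differentiable_atlas:
  assumes "smooth_manifold X A"
  shows "differentiable_atlas A"
proof
  have chart: "is_chart X c" if "c \<in> A" for c
    using assms that by (simp add: smooth_manifold_def)
  have dom: "topspace (subtopology X (fst c)) = fst c" if "c \<in> A" for c
    using chart[OF that] unfolding is_chart_def by (metis openin_subset topspace_subtopology_subset)
  show "inj_on (snd c) (fst c)" if "c \<in> A" for c
    using chart[OF that] homeomorphic_imp_injective_map dom[OF that] unfolding is_chart_def by metis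
  show open_overlap: "open (snd c ` (fst c \<inter> fst d))" if "c \<in> A" "d \<in> A" for c d
  proof -
    have "openin (subtopology X (fst c)) (fst c \<inter> fst d)"
      using chart that by (simp add: is_chart_def openin_subtopology_Int2)
    moreover have "open_map (subtopology X (fst c)) (top_of_set (chart_image c)) (snd c)"
      using chart that by (simp add: is_chart_def homeomorphic_imp_open_map)
    ultimately have "openin (top_of_set (chart_image c)) (snd c ` (fst c \<inter> fst d))"
      by (simp add: open_map_def)
    then show ?thesis
      using chart[OF that(1)] openin_open_trans by (auto simp: is_chart_def)
  qed
  show "transition c d differentiable at (snd c q)"
    if "c \<in> A" "d \<in> A" "q \<in> fst c" "q \<in> fst d" for c d q
  proof -
    have "smooth_on (snd c ` (fst c \<inter> fst d)) (transition c d)"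
      using assms that by (simp add: smooth_manifold_def compatible_def)
    then show ?thesis
      by (rule smooth_on_differentiable_at(1)[OF _ open_overlap[OF that(1,2)]]) (use that in auto)
  qed
qed

text \<open>The second derivative of the base transitions: it is what makes the transitions of the
  dual jet bundle differentiable.\<close>

lemma smooth_manifold_differential_differentiable:
  assumes "smooth_manifold X A" "c \<in> A" "d \<in> A" "q \<in> fst c" "q \<in> fst d"
  shows "(\<lambda>y. frechet_derivative (transition c d) (at y) u) differentiable at (snd c q)"
proof -
  interpret differentiable_atlas A
    using assms(1) by (rule smooth_manifold_imp_differentiable_atlas)
  have "smooth_on (snd c ` (fst c \<inter> fst d)) (transition c d)"
    using assms by (simp add: smooth_manifold_def compatible_def)
  then show ?thesis
    by (rule smooth_on_differentiable_at(2)[OF _ open_overlap[OF assms(2,3)]]) (use assms in auto)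
qed

text \<open>With the standard basis at hand, the differentials of the transitions become the Jacobian
  matrices \<open>coord_change\<close>.\<close>

locale vec_atlas = differentiable_atlas A for A :: "('a, real^'m::finite) chart set"
begin

lemma D_eq_coord_change:
  assumes "c \<in> charts_at A q" "c' \<in> charts_at A q"
  shows "D c c' q u = coord_change c c' q *v u"
  using matrix_vector_mul(2)[OF linear_D[OF assms]]
  unfolding coord_change_def jacobian_def by metis

lemma coord_change_self: "c \<in> charts_at A q \<Longrightarrow> coord_change c c q = mat 1"
  by (simp add: matrix_eq D_self flip: D_eq_coord_change)

lemma coord_change_cocycle:
  assumes "c \<in> charts_at A q" "c' \<in> charts_at A q" "c'' \<in> charts_at A q"
  shows "coord_change c' c'' q ** coord_change c c' q = coord_change c c'' q"
  using D_cocycle[OF assms] D_eq_coord_change assms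
  by (simp add: matrix_eq flip: matrix_vector_mul_assoc)

lemma coord_change_inverse:
  assumes "c \<in> charts_at A q" "c' \<in> charts_at A q"
  shows "coord_change c' c q ** coord_change c c' q = mat 1"
  using coord_change_cocycle[OF assms assms(1)] coord_change_self[OF assms(1)] by simp

end

section \<open>Jets and momenta\<close>

locale manifold_pair =
  fixes T :: "'a topology" and A :: "('a, real^'m::finite) chart set"
    and M :: "'b topology" and B :: "('b, real^'n::finite) chart set"
  assumes manifold_T: "smooth_manifold T A" and manifold_M: "smooth_manifold M B"
begin

sublocale time: vec_atlas A
  unfolding vec_atlas_def using manifold_T by (rule smooth_manifold_imp_differentiable_atlas)

sublocale space: vec_atlas B
  unfolding vec_atlas_def using manifold_M by (rule smooth_manifold_imp_differentiable_atlas)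

text \<open>\<open>smooth_near\<close> provides one pair of charts \<open>c0\<close>, \<open>d0\<close> in which \<open>f\<close> is differentiable;
  near \<open>t\<close> any other local representative is the one in \<open>c0\<close>, \<open>d0\<close> composed with transition
  maps on both sides.\<close>

lemma has_derivative_local_rep:
  assumes "smooth_near A B t f"
  obtains c0 d0 L where "c0 \<in> charts_at A t" "d0 \<in> charts_at B (f t)"
    "\<And>c d. c \<in> charts_at A t \<Longrightarrow> d \<in> charts_at B (f t) \<Longrightarrow>
      ((\<lambda>y. snd d (f (chart_inv c y))) has_derivative
        (\<lambda>u. coord_change d0 d (f t) *v (L *v (coord_change c c0 t *v u)))) (at (snd c t))"
proof -
  obtain c0 d0 W where c0: "c0 \<in> charts_at A t" and d0: "d0 \<in> charts_at B (f t)"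
    and W: "open W" "snd c0 t \<in> W" "\<And>y. y \<in> W \<Longrightarrow> f (chart_inv c0 y) \<in> fst d0"
    and smooth: "smooth_on W (\<lambda>y. snd d0 (f (chart_inv c0 y)))"
    using assms unfolding smooth_near_def by blast
  define rep where "rep = (\<lambda>y. snd d0 (f (chart_inv c0 y)))"
  define L where "L = jacobian rep (at (snd c0 t))"
  have rep: "(rep has_derivative (\<lambda>u. L *v u)) (at (snd c0 t))"
    using smooth_on_differentiable_at(1)[OF smooth W(1,2)]
    unfolding L_def rep_def by (simp add: jacobian_works)
  have "((\<lambda>y. snd d (f (chart_inv c y))) has_derivative
        (\<lambda>u. coord_change d0 d (f t) *v (L *v (coord_change c c0 t *v u)))) (at (snd c t))"
    if c: "c \<in> charts_at A t" and d: "d \<in> charts_at B (f t)" for c d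
  proof -
    have mem: "c \<in> A" "c0 \<in> A" "t \<in> fst c" "t \<in> fst c0" "d0 \<in> B" "f t \<in> fst d0"
      using c c0 d0 by (auto simp: charts_at_def)
    have der: "(transition c c0 has_derivative (\<lambda>u. coord_change c c0 t *v u)) (at (snd c t))"
      "(transition d0 d has_derivative (\<lambda>u. coord_change d0 d (f t) *v u)) (at (snd d0 (f t)))"
      using time.has_derivative_transition[OF c c0] space.has_derivative_transition[OF d0 d]
      by (simp_all add: time.D_eq_coord_change[OF c c0, abs_def] 
          space.D_eq_coord_change[OF d0 d, abs_def] ext)
    have tr: "transition c c0 (snd c t) = snd c0 t"
      using mem by (simp add: transition_def)
    have rep_t: "rep (snd c0 t) = snd d0 (f t)"
      using mem by (simp add: rep_def)
    have *: "((\<lambda>y. transition d0 d (rep (transition c c0 y))) has_derivative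
        (\<lambda>u. coord_change d0 d (f t) *v (L *v (coord_change c c0 t *v u)))) (at (snd c t))"
      by (rule has_derivative_compose[OF has_derivative_compose[OF der(1)]])
         (use der rep in \<open>simp_all add: tr rep_t\<close>)
    \<comment> \<open>The factorisation through \<open>c0\<close>, \<open>d0\<close> is valid once \<open>y\<close> is so close to \<open>t\<close> that its image
      in the chart \<open>c0\<close> lies in \<open>W\<close>.\<close>
    have "filterlim (transition c c0) (nhds (snd c0 t)) (nhds (snd c t))"
      using has_derivative_continuous[OF der(1)]
        tendsto_at_iff_tendsto_nhds[of "transition c c0" "snd c t"]
      by (simp add: continuous_at tr)
    then have "eventually (\<lambda>y. transition c c0 y \<in> W) (nhds (snd c t))"
      using W(1,2) by (rule topological_tendstoD)
    then have "eventually (\<lambda>y. transition d0 d (rep (transition c c0 y))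
        = snd d (f (chart_inv c y))) (nhds (snd c t))"
      using time.eventually_overlap[OF mem(1-4)]
    proof eventually_elim
      case (elim y)
      then have "f (chart_inv c y) \<in> fst d0"
        using W(3)[of "transition c c0 y"] mem by (simp add: transition_def)
      with elim mem show ?case
        by (simp add: transition_def rep_def)
    qed
    with * show ?thesis
      by (rule has_derivative_cong_nhds)
  qed
  with c0 d0 show ?thesis by (rule that)
qed

lemma jet_change_of_charts:
  assumes "j \<in> jet_fibre A B t x" "c \<in> charts_at A t" "c' \<in> charts_at A t"
    "d \<in> charts_at B x" "d' \<in> charts_at B x"
  shows "j (c', d') = coord_change d d' x ** j (c, d) ** coord_change c' c t"
proof -
  obtain f where f: "smooth_near A B t f" "f t = x" and j: "j = jet_of A B t f"
    using assms(1) by (auto simp: jet_fibre_def)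
  obtain c0 d0 L where c0: "c0 \<in> charts_at A t" and d0: "d0 \<in> charts_at B x"
    and der: "\<And>c d. c \<in> charts_at A t \<Longrightarrow> d \<in> charts_at B x \<Longrightarrow>
      ((\<lambda>y. snd d (f (chart_inv c y))) has_derivative
        (\<lambda>u. coord_change d0 d x *v (L *v (coord_change c c0 t *v u)))) (at (snd c t))"
    using has_derivative_local_rep[OF f(1)] unfolding f(2) by blast
  have jet: "j (c, d) = coord_change d0 d x ** L ** coord_change c c0 t"
    if "c \<in> charts_at A t" "d \<in> charts_at B x" for c d
  proof -
    have "(\<lambda>u. coord_change d0 d x *v (L *v (coord_change c c0 t *v u)))
        = (\<lambda>u. (coord_change d0 d x ** L ** coord_change c c0 t) *v u)"
      by (simp add: matrix_vector_mul_assoc matrix_mul_assoc)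
    with frechet_derivative_at[OF der[OF that], symmetric] that f(2) show ?thesis
      by (simp add: j jet_of_def jacobian_def)
  qed
  show ?thesis
    using jet[OF assms(2,4)] jet[OF assms(3,5)]
      space.coord_change_cocycle[OF d0 assms(4,5), symmetric]
      time.coord_change_cocycle[OF assms(3,2) c0, symmetric]
    by (simp add: matrix_mul_assoc)
qed

text \<open>The only candidate for a jet with coordinates \<open>P\<close> in the charts \<open>c\<close>, \<open>d\<close>, by
  \<open>jet_change_of_charts\<close>. It is the inverse of reading off coordinates, and its linearity in \<open>P\<close>
  is what makes the jet fibre a vector space.\<close>

definition jet_of_matrix where
  "jet_of_matrix c d t x P = (\<lambda>(c', d').
     if c' \<in> charts_at A t \<and> d' \<in> charts_at B x
     then coord_change d d' x ** P ** coord_change c' c t else 0)"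

lemma jet_eq_jet_of_matrix:
  assumes "j \<in> jet_fibre A B t x" "c \<in> charts_at A t" "d \<in> charts_at B x"
  shows "j = jet_of_matrix c d t x (j (c, d))"
proof
  fix k :: "('a, real^'m) chart \<times> ('b, real^'n) chart"
  obtain c' d' where k: "k = (c', d')" by (cases k)
  show "j k = jet_of_matrix c d t x (j (c, d)) k"
  proof (cases "c' \<in> charts_at A t \<and> d' \<in> charts_at B x")
    case True
    then show ?thesis
      using jet_change_of_charts[OF assms(1,2) _ assms(3)] by (simp add: k jet_of_matrix_def)
  next
    case False
    then show ?thesis
      using assms(1) by (auto simp: k jet_of_matrix_def jet_fibre_def jet_of_def)
  qed
qed

lemma jet_of_matrix_chart:
  assumes "c \<in> charts_at A t" "d \<in> charts_at B x"
  shows "jet_of_matrix c d t x P (c, d) = P"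
  using assms by (simp add: jet_of_matrix_def time.coord_change_self space.coord_change_self)

lemma jet_of_matrix_lincomb:
  "jet_of_matrix c d t x (a *\<^sub>R P + b *\<^sub>R Q)
    = (\<lambda>k. a *\<^sub>R jet_of_matrix c d t x P k + b *\<^sub>R jet_of_matrix c d t x Q k)"
  by (auto simp: jet_of_matrix_def fun_eq_iff matrix_sandwich_lincomb)

text \<open>Every matrix is the derivative of a map that is affine in the charts \<open>c\<close>, \<open>d\<close>; the open
  set \<open>W\<close> below consists of the points that this affine map keeps inside the chart.\<close>

lemma jet_of_matrix_in_jet_fibre:
  assumes c: "c \<in> charts_at A t" and d: "d \<in> charts_at B x"
  shows "jet_of_matrix c d t x P \<in> jet_fibre A B t x"
proof -
  have mem: "c \<in> A" "t \<in> fst c" "d \<in> B" "x \<in> fst d"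
    using c d by (auto simp: charts_at_def)
  define aff where "aff = (\<lambda>y. snd d x + P *v (y - snd c t))"
  define f where "f = (\<lambda>q. chart_inv d (aff (snd c q)))"
  define W where "W = chart_image c \<inter> aff -` chart_image d"
  have ft: "f t = x"
    using mem by (simp add: f_def aff_def)
  have aff_der: "(aff has_derivative (\<lambda>u. P *v u)) (at y)" for y
    unfolding aff_def
    by (auto intro!: derivative_eq_intros
        bounded_linear.has_derivative[OF matrix_vector_mul_bounded_linear])
  have W: "open W" "snd c t \<in> W"
    using time.open_overlap[of c c] space.open_overlap[of d d] mem has_derivative_continuous[OF aff_der]
    by (auto simp: W_def aff_def[of] intro!: open_Int continuous_open_vimage)
  have rep: "snd d (f (chart_inv c y)) = aff y" "f (chart_inv c y) \<in> fst d" if "y \<in> W" for y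
    using that mem by (auto simp: W_def f_def)
  have "smooth_on W (\<lambda>y. snd d (f (chart_inv c y)))"
    using smooth_on_cong[OF W(1) rep(1)] smooth_on_affine[OF matrix_vector_mul_bounded_linear]
    by (simp add: aff_def)
  then have near: "smooth_near A B t f"
    unfolding smooth_near_def
    using c d ft W rep(2)
    by (intro bexI[of _ c] bexI[of _ d] exI[of _ W]) (auto simp: W_def)
  then have fib: "jet_of A B t f \<in> jet_fibre A B t x"
    using ft by (auto simp: jet_fibre_def)
  have "((\<lambda>y. snd d (f (chart_inv c y))) has_derivative (\<lambda>u. P *v u)) (at (snd c t))"
    by (rule has_derivative_cong_nhds[OF aff_der])
       (use W rep(1) in \<open>auto simp: eventually_nhds\<close>)
  from frechet_derivative_at[OF this, symmetric]
  have "jet_of A B t f (c, d) = P"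
    using c d ft by (simp add: jet_of_def jacobian_def)
  with jet_eq_jet_of_matrix[OF fib c d] fib show ?thesis
    by simp
qed

lemma jet_fibre_lincomb:
  assumes "t \<in> atlas_carrier A" "x \<in> atlas_carrier B"
    and "u \<in> jet_fibre A B t x" "v \<in> jet_fibre A B t x"
  shows "(\<lambda>k. a *\<^sub>R u k + b *\<^sub>R v k) \<in> jet_fibre A B t x"
proof -
  obtain c d where c: "c \<in> charts_at A t" and d: "d \<in> charts_at B x"
    using assms(1,2) by (auto simp: atlas_carrier_def charts_at_def)
  have "(\<lambda>k. a *\<^sub>R u k + b *\<^sub>R v k) = jet_of_matrix c d t x (a *\<^sub>R u (c, d) + b *\<^sub>R v (c, d))"
    using jet_eq_jet_of_matrix[OF assms(3) c d] jet_eq_jet_of_matrix[OF assms(4) c d]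
    by (simp add: jet_of_matrix_lincomb)
  then show ?thesis
    using jet_of_matrix_in_jet_fibre[OF c d] by simp
qed

text \<open>A jet may have any matrix as its coordinates, so the pairing with jets determines the
  momentum, and the definite description in \<open>momentum\<close> is met by at most one matrix.\<close>

lemma momentum_eqI:
  assumes c: "c \<in> charts_at A t" and d: "d \<in> charts_at B x"
    and p: "\<And>j. j \<in> jet_fibre A B t x \<Longrightarrow> \<omega> j = p \<bullet> j (c, d)"
  shows "momentum A B c d (t, x, \<omega>) = p"
proof -
  have "q = p" if q: "\<forall>j\<in>jet_fibre A B t x. \<omega> j = q \<bullet> j (c, d)" for q
  proof -
    have "q \<bullet> P = p \<bullet> P" for P
      using p[OF jet_of_matrix_in_jet_fibre[OF c d]] q jet_of_matrix_in_jet_fibre[OF c d]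
      by (metis jet_of_matrix_chart[OF c d])
    then show ?thesis
      using vector_eq_rdot by blast
  qed
  moreover have pairing: "q \<bullet> P = (\<Sum>i\<in>UNIV. \<Sum>a\<in>UNIV. q $ i $ a * P $ i $ a)" for q P :: "real^'m^'n"
    by (simp add: inner_vec_def)
  ultimately show ?thesis
    using p unfolding momentum_def prod.case pairing by (intro the_equality) blast+
qed

text \<open>Existence of the momentum: through \<open>jet_of_matrix\<close> a functional on jets becomes a linear
  functional on matrices, which is the pairing with the value at \<open>1\<close> of its adjoint.\<close>

lemma dual_jet_eq_momentum:
  assumes c: "c \<in> charts_at A t" and d: "d \<in> charts_at B x"
    and \<omega>: "\<omega> \<in> dual_space (jet_fibre A B t x)" and j: "j \<in> jet_fibre A B t x"
  shows "\<omega> j = momentum A B c d (t, x, \<omega>) \<bullet> j (c, d)"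
proof -
  let ?f = "\<lambda>P. \<omega> (jet_of_matrix c d t x P)"
  have *: "?f (a *\<^sub>R P + b *\<^sub>R Q) = a * ?f P + b * ?f Q" for a b P Q
    using \<omega> jet_of_matrix_in_jet_fibre[OF c d]
    unfolding jet_of_matrix_lincomb dual_space_def by blast
  have lin: "linear ?f"
    using *[of 1 _ 1] *[of _ _ 0] by (intro linearI) auto
  have eq: "\<omega> j = adjoint ?f 1 \<bullet> j (c, d)" if "j \<in> jet_fibre A B t x" for j
    using adjoint_works[OF lin, of "j (c, d)" 1] jet_eq_jet_of_matrix[OF that c d]
    by (simp add: inner_commute)
  have "momentum A B c d (t, x, \<omega>) = adjoint ?f 1"
    using eq by (rule momentum_eqI[OF c d])
  with eq[OF j] show ?thesis
    by simp
qed

lemma dual_jet_of_momentum: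
  assumes c: "c \<in> charts_at A t" and d: "d \<in> charts_at B x"
  obtains \<omega> where "\<omega> \<in> dual_space (jet_fibre A B t x)" "momentum A B c d (t, x, \<omega>) = p"
proof
  have carrier: "t \<in> atlas_carrier A" "x \<in> atlas_carrier B"
    using c d by (auto simp: charts_at_def atlas_carrier_def)
  show "restrict (\<lambda>j. p \<bullet> j (c, d)) (jet_fibre A B t x) \<in> dual_space (jet_fibre A B t x)"
    by (auto simp: dual_space_def jet_fibre_lincomb[OF carrier] inner_add_right)
  show "momentum A B c d (t, x, restrict (\<lambda>j. p \<bullet> j (c, d)) (jet_fibre A B t x)) = p"
    by (rule momentum_eqI[OF c d]) simp
qed

text \<open>The transformation rule for momenta is dual to the one for jets.\<close>

lemma momentum_change_of_charts:
  assumes c: "c \<in> charts_at A t" "c' \<in> charts_at A t" and d: "d \<in> charts_at B x" "d' \<in> charts_at B x"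
    and \<omega>: "\<omega> \<in> dual_space (jet_fibre A B t x)"
  shows "momentum A B c' d' (t, x, \<omega>) =
    transpose (coord_change d' d x) ** momentum A B c d (t, x, \<omega>) ** transpose (coord_change c c' t)"
proof (rule momentum_eqI[OF c(2) d(2)])
  fix j assume j: "j \<in> jet_fibre A B t x"
  have "\<omega> j = momentum A B c d (t, x, \<omega>) \<bullet>
      (coord_change d' d x ** (j (c', d') ** coord_change c c' t))"
    using dual_jet_eq_momentum[OF c(1) d(1) \<omega> j] jet_change_of_charts[OF j c(2,1) d(2,1)]
    by (simp add: matrix_mul_assoc)
  then show "\<omega> j = (transpose (coord_change d' d x) ** momentum A B c d (t, x, \<omega>) **
      transpose (coord_change c c' t)) \<bullet> j (c', d')"
    unfolding inner_matrix_matrix_mult_right[where Q = "transpose (coord_change c c' t)"]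
    by (simp only: inner_matrix_matrix_mult_left transpose_transpose)
qed

end

section \<open>The induced atlas of the dual jet bundle\<close>

lemma bounded_bilinear_matrix_matrix_mult:
  "bounded_bilinear ((**) :: real^'k^'n \<Rightarrow> real^'m^'k \<Rightarrow> real^'m^'n)"
  unfolding bilinear_conv_bounded_bilinear[symmetric] bilinear_def
  by (auto intro!: linearI
      simp: vec_eq_iff matrix_matrix_mult_def sum_distrib_left sum_distrib_right sum.distrib
        algebra_simps)

lemma bounded_linear_transpose:
  "bounded_linear (transpose :: real^'m^'n \<Rightarrow> real^'n^'m)"
  unfolding linear_conv_bounded_linear[symmetric]
  by (auto intro!: linearI simp: transpose_def vec_eq_iff)

lemma differentiable_matrix_matrix_mult:
  fixes f :: "'e::real_normed_vector \<Rightarrow> real^'k^'n" and g :: "'e \<Rightarrow> real^'m^'k"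
  assumes "f differentiable at x" "g differentiable at x"
  shows "(\<lambda>y. f y ** g y) differentiable at x"
  using assms bounded_bilinear.FDERIV[OF bounded_bilinear_matrix_matrix_mult]
  unfolding differentiable_def by blast

lemma differentiable_transpose:
  fixes f :: "'e::real_normed_vector \<Rightarrow> real^'m^'n"
  assumes "f differentiable at x"
  shows "(\<lambda>y. transpose (f y)) differentiable at x"
  using assms bounded_linear.has_derivative[OF bounded_linear_transpose]
  unfolding differentiable_def by blast

lemma differentiable_jacobian:
  fixes f :: "real^'m \<Rightarrow> real^'n"
  assumes "\<And>u. (\<lambda>y. frechet_derivative f (at y) u) differentiable at x"
  shows "(\<lambda>y. jacobian f (at y)) differentiable at x"
proof -
  have "(\<lambda>y. frechet_derivative f (at y) (axis j 1) \<bullet> axis i 1) differentiable at x" for i j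
    using assms[of "axis j 1"] differentiable_componentwise_within[of _ x UNIV]
    by (simp add: Basis_vec_def)
  then show ?thesis
    by (subst differentiable_componentwise_within)
       (auto simp: Basis_vec_def jacobian_def matrix_def inner_axis)
qed

context manifold_pair
begin

abbreviation ind where "ind c d \<equiv> induced_chart A B c d"
abbreviation IA where "IA \<equiv> induced_atlas A B"

lemma mem_induced_chart:
  assumes "c \<in> A" "d \<in> B"
  shows "(t, x, \<omega>) \<in> fst (ind c d) \<longleftrightarrow>
    c \<in> charts_at A t \<and> d \<in> charts_at B x \<and> \<omega> \<in> dual_space (jet_fibre A B t x)"
  using assms by (auto simp: induced_chart_def dual_jet_bundle_def charts_at_def atlas_carrier_def)

lemma induced_chart_apply:
  "snd (ind c d) (t, x, \<omega>) = (snd c t, snd d x, momentum A B c d (t, x, \<omega>))"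
  by (simp add: induced_chart_def)

text \<open>Momenta are unrestricted, by \<open>dual_jet_of_momentum\<close>; so the image of an overlap is a product
  with the full space of matrices as last factor, and in particular it is open.\<close>

lemma induced_chart_overlap_image:
  assumes "c \<in> A" "c' \<in> A" "d \<in> B" "d' \<in> B"
  shows "snd (ind c d) ` (fst (ind c d) \<inter> fst (ind c' d'))
    = (snd c ` (fst c \<inter> fst c')) \<times> (snd d ` (fst d \<inter> fst d')) \<times> UNIV"
proof (intro equalityI subsetI)
  fix u assume "u \<in> snd (ind c d) ` (fst (ind c d) \<inter> fst (ind c' d'))"
  then obtain t x \<omega> where "(t, x, \<omega>) \<in> fst (ind c d)" "(t, x, \<omega>) \<in> fst (ind c' d')"
    and u: "u = snd (ind c d) (t, x, \<omega>)"
    by auto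
  then show "u \<in> (snd c ` (fst c \<inter> fst c')) \<times> (snd d ` (fst d \<inter> fst d')) \<times> UNIV"
    using assms by (auto simp: mem_induced_chart induced_chart_apply charts_at_def)
next
  fix u assume "u \<in> (snd c ` (fst c \<inter> fst c')) \<times> (snd d ` (fst d \<inter> fst d')) \<times> (UNIV :: (real^'m^'n) set)"
  then obtain t x p where u: "u = (snd c t, snd d x, p)"
    and t: "t \<in> fst c" "t \<in> fst c'" and x: "x \<in> fst d" "x \<in> fst d'"
    by auto
  have charts: "c \<in> charts_at A t" "c' \<in> charts_at A t" "d \<in> charts_at B x" "d' \<in> charts_at B x"
    using assms t x by (auto simp: charts_at_def)
  obtain \<omega> where "\<omega> \<in> dual_space (jet_fibre A B t x)" "momentum A B c d (t, x, \<omega>) = p"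
    using dual_jet_of_momentum[OF charts(1,3)] .
  then show "u \<in> snd (ind c d) ` (fst (ind c d) \<inter> fst (ind c' d'))"
    using assms charts
    by (intro image_eqI[of _ _ "(t, x, \<omega>)"]) (auto simp: u mem_induced_chart induced_chart_apply)
qed

text \<open>The elements of \<open>dual_space\<close> are extensional, so a functional is determined by its values
  on jets and hence by its momentum.\<close>

lemma inj_on_induced_chart:
  assumes "c \<in> A" "d \<in> B"
  shows "inj_on (snd (ind c d)) (fst (ind c d))"
proof (rule inj_onI)
  fix e e' assume asm: "e \<in> fst (ind c d)" "e' \<in> fst (ind c d)" "snd (ind c d) e = snd (ind c d) e'"
  obtain t x \<omega> t' x' \<omega>' where ee': "e = (t, x, \<omega>)" "e' = (t', x', \<omega>')"
    by (cases e, cases e')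
  note e = asm(1,2)[unfolded ee'] and eq = asm(3)[unfolded ee']
  have charts: "c \<in> charts_at A t" "d \<in> charts_at B x" "c \<in> charts_at A t'" "d \<in> charts_at B x'"
    and dual: "\<omega> \<in> dual_space (jet_fibre A B t x)" "\<omega>' \<in> dual_space (jet_fibre A B t' x')"
    using e assms by (auto simp: mem_induced_chart)
  have "t = t'" "x = x'"
    using eq charts time.inj_chart[OF assms(1)] space.inj_chart[OF assms(2)]
    by (auto simp: induced_chart_apply charts_at_def inj_on_def)
  moreover have "\<omega> = \<omega>'"
  proof
    fix j
    show "\<omega> j = \<omega>' j"
    proof (cases "j \<in> jet_fibre A B t x")
      case True
      then show ?thesis
        using dual_jet_eq_momentum[OF charts(1,2) dual(1) True]
          dual_jet_eq_momentum[OF charts(3,4) dual(2)] eq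
        by (simp add: \<open>t = t'\<close> \<open>x = x'\<close> induced_chart_apply)
    next
      case False
      then show ?thesis
        using dual by (auto simp: \<open>t = t'\<close> \<open>x = x'\<close> dual_space_def extensional_def)
    qed
  qed
  ultimately show "e = e'" by (simp add: ee')
qed

lemma chart_inv_induced_chart:
  assumes "c \<in> A" "d \<in> B" "e \<in> fst (ind c d)"
  shows "chart_inv (ind c d) (snd (ind c d) e) = e"
  using inj_on_induced_chart[OF assms(1,2)] assms(3) by (simp add: chart_inv_def)

text \<open>The momentum part of a transition map. The Jacobian of \<open>transition d' d\<close> belongs to the point
  of \<open>d'\<close> that corresponds to \<open>z\<close>, hence the inner transition.\<close>

definition momentum_change where
  "momentum_change c c' d d' = (\<lambda>(y, z, p).
     transpose (jacobian (transition d' d) (at (transition d d' z))) ** p **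
     transpose (jacobian (transition c c') (at y)))"

lemma transition_induced_chart:
  assumes "c \<in> A" "c' \<in> A" "d \<in> B" "d' \<in> B"
    and "u \<in> snd (ind c d) ` (fst (ind c d) \<inter> fst (ind c' d'))"
  shows "transition (ind c d) (ind c' d') u
    = (transition c c' (fst u), transition d d' (fst (snd u)), momentum_change c c' d d' u)"
proof -
  obtain t x \<omega> where e: "(t, x, \<omega>) \<in> fst (ind c d)" "(t, x, \<omega>) \<in> fst (ind c' d')"
    and u: "u = snd (ind c d) (t, x, \<omega>)"
    using assms(5) by auto
  have charts: "c \<in> charts_at A t" "c' \<in> charts_at A t" "d \<in> charts_at B x" "d' \<in> charts_at B x"
    and dual: "\<omega> \<in> dual_space (jet_fibre A B t x)"
    using e assms by (auto simp: mem_induced_chart)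
  then have tr: "transition c c' (snd c t) = snd c' t" "transition d d' (snd d x) = snd d' x"
    by (auto simp: transition_def charts_at_def)
  show ?thesis
    using chart_inv_induced_chart[OF assms(1,3) e(1)] tr
      momentum_change_of_charts[OF charts dual]
    unfolding u induced_chart_apply momentum_change_def coord_change_def
    by (simp add: transition_def[of "ind c d"] induced_chart_apply)
qed

lemma momentum_change_differentiable:
  assumes c: "c \<in> charts_at A t" "c' \<in> charts_at A t" and d: "d \<in> charts_at B x" "d' \<in> charts_at B x"
  shows "momentum_change c c' d d' differentiable at (snd c t, snd d x, p)"
proof -
  have mem: "c \<in> A" "c' \<in> A" "t \<in> fst c" "t \<in> fst c'" "d \<in> B" "d' \<in> B" "x \<in> fst d" "x \<in> fst d'"
    using c d by (auto simp: charts_at_def)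
  have tr: "transition d d' (snd d x) = snd d' x"
    using mem by (simp add: transition_def)
  have C: "(\<lambda>y. jacobian (transition c c') (at y)) differentiable at (snd c t)"
    by (intro differentiable_jacobian smooth_manifold_differential_differentiable[OF manifold_T] mem)
  have "(\<lambda>z. jacobian (transition d' d) (at z)) differentiable at (snd d' x)"
    by (intro differentiable_jacobian smooth_manifold_differential_differentiable[OF manifold_M] mem)
  then have J: "(\<lambda>z. jacobian (transition d' d) (at (transition d d' z))) differentiable at (snd d x)"
    using differentiable_compose[of "\<lambda>z. jacobian (transition d' d) (at z)" "transition d d'"]
      space.transition_differentiable mem by (simp add: tr)
  have proj: "fst differentiable at u" "(\<lambda>u. fst (snd u)) differentiable at u"
    "(\<lambda>u. snd (snd u)) differentiable at u" for u :: "('m, 'n) dual_jet_coords"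
    by (auto intro!: bounded_linear_imp_differentiable bounded_linear_intros)
  have "(\<lambda>u. transpose (jacobian (transition d' d) (at (transition d d' (fst (snd u)))))) differentiable
      at (snd c t, snd d x, p)"
    using differentiable_compose[OF _ proj(2), of "\<lambda>z. jacobian (transition d' d) (at (transition d d' z))"] J
    by (intro differentiable_transpose) simp
  moreover have "(\<lambda>u. transpose (jacobian (transition c c') (at (fst u)))) differentiable
      at (snd c t, snd d x, p)"
    using differentiable_compose[OF _ proj(1), of "\<lambda>y. jacobian (transition c c') (at y)"] C
    by (intro differentiable_transpose) simp
  ultimately show ?thesis
    unfolding momentum_change_def case_prod_unfold
    by (intro differentiable_matrix_matrix_mult proj)
qed

lemma eventually_transition_induced_chart:
  assumes "c \<in> A" "c' \<in> A" "d \<in> B" "d' \<in> B" "e \<in> fst (ind c d)" "e \<in> fst (ind c' d')"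
  shows "eventually (\<lambda>u. (transition c c' (fst u), transition d d' (fst (snd u)),
    momentum_change c c' d d' u) = transition (ind c d) (ind c' d') u) (nhds (snd (ind c d) e))"
proof -
  have "open (snd (ind c d) ` (fst (ind c d) \<inter> fst (ind c' d')))"
    unfolding induced_chart_overlap_image[OF assms(1-4)]
    using time.open_overlap space.open_overlap assms by (intro open_Times) auto
  then show ?thesis
    unfolding eventually_nhds
    using transition_induced_chart[OF assms(1-4)] assms(5,6)
    by (intro exI[of _ "snd (ind c d) ` (fst (ind c d) \<inter> fst (ind c' d'))"]) auto
qed

text \<open>The differential of a transition map in block form. The block \<open>E\<close> depends on second derivatives
  of the base transitions, but for momentum directions it is explicit, since the new momentum is
  linear in the old one while the base point is held fixed.\<close>

lemma has_derivative_transition_induced_chart: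
  assumes "c \<in> A" "c' \<in> A" "d \<in> B" "d' \<in> B"
    and "(t, x, \<omega>) \<in> fst (ind c d)" "(t, x, \<omega>) \<in> fst (ind c' d')"
  obtains E where "(transition (ind c d) (ind c' d') has_derivative
      (\<lambda>u. (coord_change c c' t *v fst u, coord_change d d' x *v fst (snd u), E u)))
      (at (snd (ind c d) (t, x, \<omega>)))"
    "\<And>\<pi>. E (0, 0, \<pi>) = transpose (coord_change d' d x) ** \<pi> ** transpose (coord_change c c' t)"
proof -
  have charts: "c \<in> charts_at A t" "c' \<in> charts_at A t" "d \<in> charts_at B x" "d' \<in> charts_at B x"
    using assms by (auto simp: mem_induced_chart)
  define p where "p = momentum A B c d (t, x, \<omega>)"
  define E where "E = frechet_derivative (momentum_change c c' d d') (at (snd c t, snd d x, p))"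
  have E: "(momentum_change c c' d d' has_derivative E) (at (snd c t, snd d x, p))"
    using momentum_change_differentiable[OF charts] by (simp add: E_def frechet_derivative_works)
  have "((\<lambda>u. transition c c' (fst u)) has_derivative (\<lambda>u. coord_change c c' t *v fst u))
      (at (snd c t, snd d x, p))"
    by (rule has_derivative_compose[OF has_derivative_fst[OF has_derivative_ident]])
       (use time.has_derivative_transition[OF charts(1,2)] in
         \<open>simp add: time.D_eq_coord_change[OF charts(1,2), abs_def]\<close>)
  moreover have "((\<lambda>u. transition d d' (fst (snd u))) has_derivative
      (\<lambda>u. coord_change d d' x *v fst (snd u))) (at (snd c t, snd d x, p))"
    by (rule has_derivative_compose[OF has_derivative_fst[OF has_derivative_snd[OF has_derivative_ident]]])
       (use space.has_derivative_transition[OF charts(3,4)] in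
         \<open>simp add: space.D_eq_coord_change[OF charts(3,4), abs_def]\<close>)
  ultimately have "((\<lambda>u. (transition c c' (fst u), transition d d' (fst (snd u)),
      momentum_change c c' d d' u)) has_derivative
      (\<lambda>u. (coord_change c c' t *v fst u, coord_change d d' x *v fst (snd u), E u)))
      (at (snd c t, snd d x, p))"
    using E by (intro has_derivative_Pair)
  moreover have pt: "snd (ind c d) (t, x, \<omega>) = (snd c t, snd d x, p)"
    by (simp add: induced_chart_apply p_def)
  ultimately have "(transition (ind c d) (ind c' d') has_derivative
      (\<lambda>u. (coord_change c c' t *v fst u, coord_change d d' x *v fst (snd u), E u)))
      (at (snd (ind c d) (t, x, \<omega>)))"
    using eventually_transition_induced_chart[OF assms] has_derivative_cong_nhds by fastforce
  moreover have "E (0, 0, \<pi>) = transpose (coord_change d' d x) ** \<pi> ** transpose (coord_change c c' t)" for \<pi>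
  proof -
    let ?K = "\<lambda>\<pi>. transpose (coord_change d' d x) ** \<pi> ** transpose (coord_change c c' t)"
    have "transition d d' (snd d x) = snd d' x"
      using charts by (simp add: transition_def charts_at_def)
    then have K: "(\<lambda>q. momentum_change c c' d d' (snd c t, snd d x, q)) = ?K"
      by (auto simp: momentum_change_def coord_change_def)
    have "linear ?K"
      using matrix_sandwich_lincomb[of _ 1 _ 1] matrix_sandwich_lincomb[of _ _ _ 0]
      by (intro linearI) auto
    then have "(?K has_derivative ?K) (at p)"
      by (simp add: linear_conv_bounded_linear bounded_linear_imp_has_derivative)
    moreover have "(?K has_derivative (\<lambda>q. E (0, 0, q))) (at p)"
      unfolding K[symmetric]
      by (rule has_derivative_compose[where f = "\<lambda>q. (snd c t, snd d x, q)" and g' = E])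
         (intro has_derivative_Pair has_derivative_const has_derivative_ident E)+
    ultimately show ?thesis
      using has_derivative_unique by metis
  qed
  ultimately show ?thesis by (rule that)
qed

sublocale cojet: differentiable_atlas IA
proof
  show "inj_on (snd k) (fst k)" if "k \<in> IA" for k
    using that inj_on_induced_chart by (auto simp: induced_atlas_def)
  show "open (snd k ` (fst k \<inter> fst k'))" if "k \<in> IA" "k' \<in> IA" for k k'
  proof -
    obtain c d c' d' where k: "k = ind c d" "k' = ind c' d'" "c \<in> A" "c' \<in> A" "d \<in> B" "d' \<in> B"
      using \<open>k \<in> IA\<close> \<open>k' \<in> IA\<close> by (auto simp: induced_atlas_def)
    show ?thesis
      unfolding k(1,2) induced_chart_overlap_image[OF k(3-6)]
      by (intro open_Times time.open_overlap space.open_overlap open_UNIV k)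
  qed
  show "transition k k' differentiable at (snd k e)"
    if "k \<in> IA" "k' \<in> IA" "e \<in> fst k" "e \<in> fst k'" for k k' e
  proof -
    obtain c d c' d' where k: "k = ind c d" "k' = ind c' d'" and
      mem: "c \<in> A" "c' \<in> A" "d \<in> B" "d' \<in> B"
      using \<open>k \<in> IA\<close> \<open>k' \<in> IA\<close> by (auto simp: induced_atlas_def)
    obtain t x \<omega> where e: "e = (t, x, \<omega>)" by (cases e)
    show ?thesis
      using has_derivative_transition_induced_chart[OF mem, of t x \<omega>] that(3,4)
      unfolding k e differentiable_def by metis
  qed
qed

end

lemma inner_x_dir: "u \<bullet> x_dir i = fst (snd u) $ i"
  by (simp add: inner_prod_def inner_axis)

lemma inner_p_dir: "u \<bullet> p_dir j b = snd (snd u) $ j $ b"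
  by (simp add: inner_prod_def inner_axis)

lemma sum_axis_matrix:
  "(\<Sum>j\<in>UNIV. \<Sum>b\<in>UNIV. P $ j $ b *\<^sub>R axis j (axis b 1)) = (P :: real^'m^'n)"
proof -
  have "(\<Sum>b\<in>UNIV. if R then f b else 0) = (if R then (\<Sum>b\<in>UNIV. f b) else 0)" for R and f :: "'m \<Rightarrow> real"
    by simp
  then show ?thesis
    by (simp add: vec_eq_iff axis_def if_distrib[of "\<lambda>v. v $ _"] if_distrib[of "\<lambda>v. _ * v"]
        cong: if_cong)
qed

section \<open>Transformation law and intertwining\<close>

text \<open>The endomorphism with coordinate expression
  \<open>dx\<^sup>i \<otimes> (\<partial>/\<partial>x\<^sup>i - N\<^bsub>(j)i\<^esub>\<^bsup>(b)\<^esup> \<partial>/\<partial>p\<^sub>j\<^sup>b)\<close>, acting on coordinate vectors \<open>(\<tau>, \<xi>, \<pi>)\<close>. It maps the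
  spatial directions to the horizontal vectors of the connection \<open>N\<close>.\<close>

definition horizontal ::
  "('n \<Rightarrow> 'n \<Rightarrow> 'm \<Rightarrow> real) \<Rightarrow> ('m::finite, 'n::finite) dual_jet_coords \<Rightarrow> ('m, 'n) dual_jet_coords" where
  "horizontal N u = (0, fst (snd u), - (\<chi> j b. \<Sum>i\<in>UNIV. N j i b * fst (snd u) $ i))"

lemma linear_horizontal: "linear (horizontal N)"
  by (intro linearI)
     (auto simp: horizontal_def vec_eq_iff sum.distrib sum_distrib_left algebra_simps)

lemma horizontal_expansion:
  "horizontal N u = (\<Sum>i\<in>UNIV. fst (snd u) $ i *\<^sub>R x_dir i)
    - (\<Sum>i\<in>UNIV. \<Sum>j\<in>UNIV. \<Sum>b\<in>UNIV. (N j i b * fst (snd u) $ i) *\<^sub>R p_dir j b)"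
proof -
  have 1: "(\<Sum>i\<in>UNIV. fst (snd u) $ i *\<^sub>R axis i (1::real)) = fst (snd u)"
    using basis_expansion[of "fst (snd u)"] by (simp add: scalar_mult_eq_scaleR)
  have 2: "(\<Sum>i\<in>UNIV. \<Sum>j\<in>UNIV. \<Sum>b\<in>UNIV. (N j i b * fst (snd u) $ i) *\<^sub>R axis j (axis b (1::real)))
      = (\<chi> j b. \<Sum>i\<in>UNIV. N j i b * fst (snd u) $ i)"
    using sum_axis_matrix[of "\<chi> j b. N j i b * fst (snd u) $ i" for i]
    by (simp add: vec_eq_iff)
  show ?thesis
    by (simp add: horizontal_def prod_eq_iff fst_sum snd_sum 1 2)
qed

text \<open>The algebraic core. \<open>F\<close> stands for the differential of a change of coordinates, \<open>C\<close> and \<open>J\<close>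
  for the Jacobians on the two base manifolds, and \<open>J'\<close> for the inverse of \<open>J\<close>. Write
  \<open>n N \<xi>\<close> for the contraction of \<open>N\<close> with \<open>\<xi>\<close>, so that \<open>horizontal N\<close> sends \<open>(\<tau>, \<xi>, \<pi>)\<close> to
  \<open>(0, \<xi>, - n N \<xi>)\<close>; let \<open>Q\<close> and \<open>K\<close> be the momentum parts of \<open>F\<close> on spatial and on momentum
  directions. On the first two components \<open>F \<circ> horizontal N\<close> and \<open>horizontal N' \<circ> F\<close> always agree.
  On the third their equality says \<open>Q \<xi> - K (n N \<xi>) = - n N' (J \<xi>)\<close>. Putting \<open>\<xi> = J' \<eta>\<close> and letting
  \<open>\<eta>\<close> run through the standard basis turns this into the transformation law, entry by entry; each
  of these steps is reversible.\<close>

lemma intertwining_iff_transformation_law: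
  fixes F :: "('m::finite, 'n::finite) dual_jet_coords \<Rightarrow> ('m, 'n) dual_jet_coords"
  assumes lin: "linear F"
    and F_t: "\<And>u. fst (F u) = C *v fst u"
    and F_x: "\<And>u. fst (snd (F u)) = J *v fst (snd u)"
    and F_p: "\<And>\<pi>. F (0, 0, \<pi>) = (0, 0, transpose J' ** \<pi> ** transpose C)"
    and inv: "J ** J' = mat 1" "J' ** J = mat 1"
  shows "(\<forall>u. F (horizontal N u) = horizontal N' (F u)) \<longleftrightarrow>
    (\<forall>j s b. N' j s b =
      (\<Sum>k\<in>UNIV. \<Sum>i\<in>UNIV. \<Sum>r\<in>UNIV. N k i r * C $ b $ r * J' $ k $ j * J' $ i $ s)
      - (\<Sum>i\<in>UNIV. J' $ i $ s * snd (snd (F (x_dir i))) $ j $ b))"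
proof -
  define n :: "('n \<Rightarrow> 'n \<Rightarrow> 'm \<Rightarrow> real) \<Rightarrow> real^'n \<Rightarrow> real^'m^'n"
    where "n = (\<lambda>N \<xi>. \<chi> j b. \<Sum>i\<in>UNIV. N j i b * \<xi> $ i)"
  define Q where "Q = (\<lambda>\<xi>. snd (snd (F (0, \<xi>, 0))))"
  define K where "K = (\<lambda>\<pi>. transpose J' ** \<pi> ** transpose C)"
  have n: "linear (n N)" for N
    by (intro linearI) (auto simp: n_def vec_eq_iff sum.distrib sum_distrib_left algebra_simps)
  have Q: "linear Q"
    using linear_add[OF lin, of "(0, _, 0)" "(0, _, 0)"] linear_scale[OF lin, of _ "(0, _, 0)"]
    by (intro linearI) (simp_all add: Q_def)
  have K: "linear K"
    unfolding K_def using matrix_sandwich_lincomb[of _ 1 _ 1] matrix_sandwich_lincomb[of _ _ _ 0]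
    by (intro linearI) auto
  have hor: "horizontal N u = (0, fst (snd u), - n N (fst (snd u)))" for N u
    by (simp add: horizontal_def n_def)
  have F: "F (0, \<xi>, \<pi>) = (0, J *v \<xi>, Q \<xi> + K \<pi>)" for \<xi> \<pi>
  proof -
    have "F (0, \<xi>, \<pi>) = F (0, \<xi>, 0) + F (0, 0, \<pi>)"
      using linear_add[OF lin, of "(0, \<xi>, 0)" "(0, 0, \<pi>)"] by simp
    moreover have "F (0, \<xi>, 0) = (0, J *v \<xi>, Q \<xi>)"
      by (simp add: prod_eq_iff F_t F_x Q_def)
    ultimately show ?thesis
      by (simp add: F_p K_def)
  qed
  have "(\<forall>u. F (horizontal N u) = horizontal N' (F u)) \<longleftrightarrow>
      (\<forall>\<xi>. Q \<xi> - K (n N \<xi>) = - n N' (J *v \<xi>))"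
    by (auto simp: hor F F_x linear_neg[OF K])
  also have "\<dots> \<longleftrightarrow> (\<forall>\<eta>. n N' \<eta> = K (n N (J' *v \<eta>)) - Q (J' *v \<eta>))"
  proof safe
    fix \<eta> assume "\<forall>\<xi>. Q \<xi> - K (n N \<xi>) = - n N' (J *v \<xi>)"
    then have "Q (J' *v \<eta>) - K (n N (J' *v \<eta>)) = - n N' (J *v (J' *v \<eta>))"
      by blast
    then show "n N' \<eta> = K (n N (J' *v \<eta>)) - Q (J' *v \<eta>)"
      by (simp add: matrix_vector_mul_assoc inv algebra_simps)
  next
    fix \<xi> assume "\<forall>\<eta>. n N' \<eta> = K (n N (J' *v \<eta>)) - Q (J' *v \<eta>)"
    then show "Q \<xi> - K (n N \<xi>) = - n N' (J *v \<xi>)"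
      by (simp add: matrix_vector_mul_assoc inv)
  qed
  also have "\<dots> \<longleftrightarrow> (\<forall>s. n N' (axis s 1) = K (n N (J' *v axis s 1)) - Q (J' *v axis s 1))"
  proof (intro iffI allI)
    fix \<eta> assume *: "\<forall>s. n N' (axis s 1) = K (n N (J' *v axis s 1)) - Q (J' *v axis s 1)"
    have "linear (\<lambda>\<eta>. K (n N (J' *v \<eta>)) - Q (J' *v \<eta>))"
      using linear_compose[OF linear_compose[OF matrix_vector_mul_linear n] K]
        linear_compose[OF matrix_vector_mul_linear Q]
      by (intro linear_compose_sub) (simp_all add: o_def)
    then have "n N' = (\<lambda>\<eta>. K (n N (J' *v \<eta>)) - Q (J' *v \<eta>))"
    proof (rule linear_eq_stdbasis[OF n])
      fix \<eta> :: "real^'n" assume "\<eta> \<in> Basis"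
      then obtain s where "\<eta> = axis s 1" by (auto simp: Basis_vec_def)
      with * show "n N' \<eta> = K (n N (J' *v \<eta>)) - Q (J' *v \<eta>)" by blast
    qed
    then show "n N' \<eta> = K (n N (J' *v \<eta>)) - Q (J' *v \<eta>)"
      by (rule fun_cong)
  qed blast
  also have "\<dots> \<longleftrightarrow> (\<forall>j s b. N' j s b =
      (\<Sum>k\<in>UNIV. \<Sum>i\<in>UNIV. \<Sum>r\<in>UNIV. N k i r * C $ b $ r * J' $ k $ j * J' $ i $ s)
      - (\<Sum>i\<in>UNIV. J' $ i $ s * snd (snd (F (x_dir i))) $ j $ b))"
  proof -
    have col: "(J' *v axis s 1) $ i = J' $ i $ s" for i s
      by (simp add: matrix_vector_mult_basis column_def)
    have n': "n N' (axis s 1) $ j $ b = N' j s b" for j s b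
      by (simp add: n_def axis_def if_distrib cong: if_cong)
    have Q': "Q (J' *v axis s 1) $ j $ b = (\<Sum>i\<in>UNIV. J' $ i $ s * snd (snd (F (x_dir i))) $ j $ b)" for j s b
    proof -
      have "J' *v axis s 1 = (\<Sum>i\<in>UNIV. J' $ i $ s *\<^sub>R axis i 1)"
        using basis_expansion[of "J' *v axis s 1"] by (simp add: scalar_mult_eq_scaleR col)
      then have "Q (J' *v axis s 1) = (\<Sum>i\<in>UNIV. J' $ i $ s *\<^sub>R Q (axis i 1))"
        by (simp add: linear_sum[OF Q] linear_scale[OF Q])
      then show ?thesis
        by (simp add: Q_def)
    qed
    have K': "K (n N (J' *v axis s 1)) $ j $ b =
        (\<Sum>k\<in>UNIV. \<Sum>i\<in>UNIV. \<Sum>r\<in>UNIV. N k i r * C $ b $ r * J' $ k $ j * J' $ i $ s)" for j s b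
    proof -
      have "K (n N (J' *v axis s 1)) $ j $ b =
          (\<Sum>r\<in>UNIV. \<Sum>k\<in>UNIV. \<Sum>i\<in>UNIV. N k i r * C $ b $ r * J' $ k $ j * J' $ i $ s)"
        by (simp add: K_def n_def matrix_matrix_mult_def transpose_def col
            sum_distrib_left sum_distrib_right mult_ac)
      also have "\<dots> = (\<Sum>k\<in>UNIV. \<Sum>r\<in>UNIV. \<Sum>i\<in>UNIV. N k i r * C $ b $ r * J' $ k $ j * J' $ i $ s)"
        by (rule sum.swap)
      also have "\<dots> = (\<Sum>k\<in>UNIV. \<Sum>i\<in>UNIV. \<Sum>r\<in>UNIV. N k i r * C $ b $ r * J' $ k $ j * J' $ i $ s)"
        by (intro sum.cong refl sum.swap)
      finally show ?thesis .
    qed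
    show ?thesis
      unfolding vec_eq_iff vector_minus_component n' Q' K' by blast
  qed
  finally show ?thesis .
qed

context manifold_pair
begin

section \<open>Semisprays and spatial connections\<close>

lemma induced_chart_in_IA: "c \<in> A \<Longrightarrow> d \<in> B \<Longrightarrow> ind c d \<in> IA"
  unfolding induced_atlas_def by blast

lemma induced_chart_in_charts_at:
  "c \<in> A \<Longrightarrow> d \<in> B \<Longrightarrow> e \<in> fst (ind c d) \<Longrightarrow> ind c d \<in> charts_at IA e"
  by (simp add: charts_at_def induced_chart_in_IA)

text \<open>The partial derivatives \<open>\<partial>p'/\<partial>x\<close> in the transformation law are entries of the differential of
  the transition map, because its momentum component is \<open>p'\<close> itself.\<close>

lemma spatial_connection_iff_intertwining:
  "spatial_connection A B N \<longleftrightarrow>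
    (\<forall>c\<in>A. \<forall>d\<in>B. \<forall>k i r. smooth_in_chart (ind c d) (\<lambda>e. N c d e k i r)) \<and>
    (\<forall>c\<in>A. \<forall>d\<in>B. \<forall>c'\<in>A. \<forall>d'\<in>B. \<forall>e \<in> fst (ind c d) \<inter> fst (ind c' d'). \<forall>u.
       cojet.D (ind c d) (ind c' d') e (horizontal (N c d e) u)
         = horizontal (N c' d' e) (cojet.D (ind c d) (ind c' d') e u))"
proof -
  have law: "(\<forall>j s b.
        N c' d' (t, x, \<omega>) j s b =
          (\<Sum>k\<in>UNIV. \<Sum>i\<in>UNIV. \<Sum>r\<in>UNIV. N c d (t, x, \<omega>) k i r *
             coord_change c c' t $ b $ r * coord_change d' d x $ k $ j * coord_change d' d x $ i $ s)
          - (\<Sum>i\<in>UNIV. coord_change d' d x $ i $ s *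
               chart_deriv (induced_chart A B c d) (\<lambda>e. momentum A B c' d' e $ j $ b)
                 (t, x, \<omega>) (x_dir i))) \<longleftrightarrow>
      (\<forall>u. cojet.D (ind c d) (ind c' d') (t, x, \<omega>) (horizontal (N c d (t, x, \<omega>)) u)
         = horizontal (N c' d' (t, x, \<omega>)) (cojet.D (ind c d) (ind c' d') (t, x, \<omega>) u))"
    if mem: "c \<in> A" "c' \<in> A" "d \<in> B" "d' \<in> B"
      and e: "(t, x, \<omega>) \<in> fst (ind c d)" "(t, x, \<omega>) \<in> fst (ind c' d')"
    for c d c' d' t x \<omega>
  proof -
    have charts: "d \<in> charts_at B x" "d' \<in> charts_at B x"
      using mem e by (auto simp: mem_induced_chart)
    let ?F = "cojet.D (ind c d) (ind c' d') (t, x, \<omega>)"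
    obtain E where der: "(transition (ind c d) (ind c' d') has_derivative
        (\<lambda>u. (coord_change c c' t *v fst u, coord_change d d' x *v fst (snd u), E u)))
        (at (snd (ind c d) (t, x, \<omega>)))"
      and E: "\<And>\<pi>. E (0, 0, \<pi>) = transpose (coord_change d' d x) ** \<pi> ** transpose (coord_change c c' t)"
      using has_derivative_transition_induced_chart[OF mem e] by blast
    have F: "?F = (\<lambda>u. (coord_change c c' t *v fst u, coord_change d d' x *v fst (snd u), E u))"
      using frechet_derivative_at[OF der] by simp
    have lin: "linear ?F"
      using has_derivative_linear[OF der] unfolding F .
    have chart_deriv: "chart_deriv (ind c d) (\<lambda>e. momentum A B c' d' e $ j $ b) (t, x, \<omega>) u
        = snd (snd (?F u)) $ j $ b" for j b u
    proof -
      have rep: "(\<lambda>y. momentum A B c' d' (chart_inv (ind c d) y) $ j $ b)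
          = (\<lambda>y. transition (ind c d) (ind c' d') y \<bullet> p_dir j b)"
        by (auto simp: inner_p_dir transition_def induced_chart_def case_prod_unfold)
      have "((\<lambda>y. transition (ind c d) (ind c' d') y \<bullet> p_dir j b) has_derivative
          (\<lambda>u. ?F u \<bullet> p_dir j b)) (at (snd (ind c d) (t, x, \<omega>)))"
        using der unfolding F by (rule has_derivative_inner_left)
      from frechet_derivative_at[OF this, symmetric] show ?thesis
        unfolding chart_deriv_def rep by (simp only: inner_p_dir)
    qed
    show ?thesis
      unfolding chart_deriv
      by (rule intertwining_iff_transformation_law[symmetric, OF lin,
            where J = "coord_change d d' x"])
         (simp_all add: F E space.coord_change_inverse[OF charts]
            space.coord_change_inverse[OF charts(2,1)])
  qed
  show ?thesis
    unfolding spatial_connection_def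
    by (intro conj_cong refl ball_cong) (simp only: split_paired_all prod.case Int_iff law)
qed

text \<open>The coordinate expression of a semispray is the (1,1)-tensor of the endomorphism
  \<open>horizontal (2 G)\<close>: it pairs a covector with the image of a tangent vector.\<close>

lemma semispray_local_form:
  assumes mem: "c \<in> A" "d \<in> B" "e \<in> fst (ind c d)"
    and v: "v \<in> tangent_space IA e" and \<omega>: "\<omega> \<in> cotangent_space IA e"
  shows "(let dx = (\<lambda>i. coord_covector IA (ind c d) e (x_dir i));
              del_x = (\<lambda>j. coord_vector IA (ind c d) e (x_dir j));
              del_p = (\<lambda>j b. coord_vector IA (ind c d) e (p_dir j b))
          in (\<Sum>i\<in>UNIV. \<Sum>j\<in>UNIV. (if i = j then 1 else 0) * tensor_prod (dx i) (del_x j) v \<omega>)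
             - 2 * (\<Sum>i\<in>UNIV. \<Sum>j\<in>UNIV. \<Sum>b\<in>UNIV. g j i b * tensor_prod (dx i) (del_p j b) v \<omega>))
    = \<omega> (coord_vector IA (ind c d) e (horizontal (\<lambda>j i b. 2 * g j i b) (v (ind c d))))"
proof -
  have lin: "linear (\<lambda>u. \<omega> (coord_vector IA (ind c d) e u))" (is "linear ?L")
    using cojet.linear_covector_coords[OF induced_chart_in_charts_at[OF mem] \<omega>] .
  have dx: "coord_covector IA (ind c d) e (x_dir i) v = fst (snd (v (ind c d))) $ i" for i
    using v by (simp add: coord_covector_def inner_x_dir)
  have "?L (horizontal (\<lambda>j i b. 2 * g j i b) (v (ind c d))) =
      (\<Sum>i\<in>UNIV. fst (snd (v (ind c d))) $ i * ?L (x_dir i))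
      - (\<Sum>i\<in>UNIV. \<Sum>j\<in>UNIV. \<Sum>b\<in>UNIV. (2 * g j i b * fst (snd (v (ind c d))) $ i) * ?L (p_dir j b))"
    by (simp add: horizontal_expansion linear_diff[OF lin] linear_sum[OF lin] linear_scale[OF lin]
        del: scaleR_Pair)
  then show ?thesis
    by (simp add: Let_def tensor_prod_def dx sum_distrib_left mult_ac if_distrib[of "\<lambda>r. r * _"]
        if_distrib[of "\<lambda>r. _ * r"] cong: if_cong)
qed

lemma spatial_semispray_iff:
  "spatial_semispray A B G Gc \<longleftrightarrow> smooth_tensor_field IA G \<and>
    (\<forall>c\<in>A. \<forall>d\<in>B. \<forall>e\<in>fst (ind c d). \<forall>v\<in>tangent_space IA e. \<forall>\<omega>\<in>cotangent_space IA e.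
      G e v \<omega> = \<omega> (coord_vector IA (ind c d) e
        (horizontal (\<lambda>j i b. 2 * Gc c d e j i b) (v (ind c d)))))"
  unfolding spatial_semispray_def
  by (intro conj_cong refl ball_cong) (simp only: Let_def semispray_local_form[unfolded Let_def])

text \<open>The same tensor is expressed in two charts. Applied to a tangent vector with coordinates \<open>u\<close> in
  the first chart and to the coordinate covectors of the second one, the two expressions give the
  components of the two sides of the intertwining relation. Within one chart, the tensor at
  \<open>\<partial>/\<partial>x\<^sup>i\<close> and \<open>dp\<^sub>k\<^sup>r\<close> is \<open>-2 G\<^bsub>(k)i\<^esub>\<^bsup>(r)\<^esup>\<close>, so that smoothness is inherited.\<close>

lemma semispray_components_form_connection:
  assumes "spatial_semispray A B G Gc"
  shows "spatial_connection A B (\<lambda>c d e j i b. 2 * Gc c d e j i b)"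
  unfolding spatial_connection_iff_intertwining
proof (intro conjI ballI allI)
  have G: "G e v \<omega> = \<omega> (coord_vector IA (ind c d) e
        (horizontal (\<lambda>j i b. 2 * Gc c d e j i b) (v (ind c d))))"
    if "c \<in> A" "d \<in> B" "e \<in> fst (ind c d)" "v \<in> tangent_space IA e" "\<omega> \<in> cotangent_space IA e"
    for c d e v \<omega>
    using assms that by (simp add: spatial_semispray_iff)
  {
    fix c d k i r assume mem: "c \<in> A" "d \<in> B"
    have open_im: "open (chart_image (ind c d))"
      using cojet.open_overlap[of "ind c d" "ind c d"] induced_chart_in_IA[OF mem] by simp
    have comp: "G e (coord_vector IA (ind c d) e (x_dir i)) (coord_covector IA (ind c d) e (p_dir k r))
        = - (2 * Gc c d e k i r)" if e: "e \<in> fst (ind c d)" for e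
    proof -
      note at = induced_chart_in_charts_at[OF mem e]
      have "G e (coord_vector IA (ind c d) e (x_dir i)) (coord_covector IA (ind c d) e (p_dir k r))
          = horizontal (\<lambda>j i b. 2 * Gc c d e j i b) (x_dir i) \<bullet> p_dir k r"
        unfolding G[OF mem e cojet.coord_vector_in_tangent_space[OF at]
            cojet.coord_covector_in_cotangent_space]
        by (simp only: cojet.coord_covector_coord_vector[OF at at] cojet.coord_vector_chart[OF at]
            cojet.D_self[OF at])
      also have "\<dots> = - (2 * Gc c d e k i r)"
        unfolding inner_p_dir by (simp add: horizontal_def axis_def if_distrib cong: if_cong)
      finally show ?thesis .
    qed
    have "smooth_in_chart (ind c d)
        (\<lambda>e. G e (coord_vector IA (ind c d) e (x_dir i)) (coord_covector IA (ind c d) e (p_dir k r)))"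
      (is "smooth_in_chart _ ?g")
    proof -
      have "x_dir i \<in> Basis" "p_dir k r \<in> Basis"
        by (simp_all add: Basis_prod_def axis_in_Basis_iff inj_image_mem_iff inj_on_def)
      then show ?thesis
        using assms induced_chart_in_IA[OF mem]
        unfolding spatial_semispray_def smooth_tensor_field_def by blast
    qed
    then have "smooth_on (chart_image (ind c d)) (\<lambda>y. (-1) *\<^sub>R ?g (chart_inv (ind c d) y))"
      unfolding smooth_in_chart_def by (intro smooth_on_scaleR open_im)
    then show "smooth_in_chart (ind c d) (\<lambda>e. 2 * Gc c d e k i r)"
      unfolding smooth_in_chart_def
      by (rule smooth_on_cong[OF open_im, THEN iffD1, rotated])
         (auto simp: chart_inv_induced_chart[OF mem] comp)
  }
  fix c d c' d' e u
  assume mem: "c \<in> A" "d \<in> B" "c' \<in> A" "d' \<in> B" and "e \<in> fst (ind c d) \<inter> fst (ind c' d')"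
  then have e: "e \<in> fst (ind c d)" "e \<in> fst (ind c' d')" by auto
  let ?D = "cojet.D (ind c d) (ind c' d') e"
  let ?N = "\<lambda>c d j i b. 2 * Gc c d e j i b"
  note at = induced_chart_in_charts_at[OF mem(1,2) e(1)] induced_chart_in_charts_at[OF mem(3,4) e(2)]
  note tan = cojet.coord_vector_in_tangent_space[OF at(1)]
    and cov = cojet.coord_covector_in_cotangent_space[of "ind c' d'" e]
  have "?D (horizontal (?N c d) u) \<bullet> w = horizontal (?N c' d') (?D u) \<bullet> w" for w
    using G[OF mem(1,2) e(1) tan[of u] cov[of w]] G[OF mem(3,4) e(2) tan[of u] cov[of w]]
    by (simp only: cojet.coord_covector_coord_vector at cojet.coord_vector_chart[OF at(1)]
        cojet.coord_vector_chart[OF at(2)] cojet.D_self[OF at(1)] cojet.D_self[OF at(2)])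
  then show "?D (horizontal (?N c d) u) = horizontal (?N c' d') (?D u)"
    using vector_eq_rdot by blast
qed

text \<open>Conversely the intertwining relation says precisely that the tensor of \<open>horizontal N\<close> may be
  computed in any chart, so a chart around each point can be chosen arbitrarily. In a fixed chart
  its components are constants plus linear combinations, with constant coefficients, of those of
  \<open>N\<close>, hence smooth.\<close>

lemma connection_gives_semispray:
  assumes N: "spatial_connection A B N"
  shows "\<exists>G. spatial_semispray A B G (\<lambda>c d e j i b. 1 / 2 * N c d e j i b)"
proof -
  define pick where "pick e = (SOME (c, d). c \<in> A \<and> d \<in> B \<and> e \<in> fst (ind c d))" for e
  define G :: "(('a, 'b, 'm, 'n) dual_jet, ('m, 'n) dual_jet_coords) tensor_field" where
    "G e v \<omega> = (case pick e of (c, d) \<Rightarrow>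
       \<omega> (coord_vector IA (ind c d) e (horizontal (N c d e) (v (ind c d)))))" for e v \<omega>
  have G: "G e v \<omega> = \<omega> (coord_vector IA (ind c d) e (horizontal (N c d e) (v (ind c d))))"
    if mem: "c \<in> A" "d \<in> B" "e \<in> fst (ind c d)" and v: "v \<in> tangent_space IA e"
    for c d e v \<omega>
  proof -
    obtain c' d' where pick: "pick e = (c', d')" by (cases "pick e")
    have mem': "c' \<in> A" "d' \<in> B" "e \<in> fst (ind c' d')"
      using someI[of "\<lambda>(c, d). c \<in> A \<and> d \<in> B \<and> e \<in> fst (ind c d)" "(c, d)"] mem pick
      by (simp_all add: pick_def)
    note at = induced_chart_in_charts_at[OF mem] induced_chart_in_charts_at[OF mem']
    have "horizontal (N c d e) (v (ind c d))
        = cojet.D (ind c' d') (ind c d) e (horizontal (N c' d' e) (v (ind c' d')))"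
    proof -
      have v_eq: "v (ind c d) = cojet.D (ind c' d') (ind c d) e (v (ind c' d'))"
        using v at unfolding tangent_space_def by blast
      have "\<forall>u. cojet.D (ind c' d') (ind c d) e (horizontal (N c' d' e) u)
          = horizontal (N c d e) (cojet.D (ind c' d') (ind c d) e u)"
        using N mem mem' unfolding spatial_connection_iff_intertwining by blast
      then show ?thesis
        by (simp only: v_eq)
    qed
    then show ?thesis
      by (simp only: G_def pick prod.case cojet.coord_vector_change[OF at(2,1)])
  qed
  have "smooth_tensor_field IA G"
    unfolding smooth_tensor_field_def
  proof (intro conjI ballI allI)
    fix e assume "e \<in> atlas_carrier IA"
    then obtain c d where mem: "c \<in> A" "d \<in> B" "e \<in> fst (ind c d)"
      unfolding atlas_carrier_def induced_atlas_def by blast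
    note at = induced_chart_in_charts_at[OF mem]
    {
      fix \<omega> u v a b
      assume \<omega>: "\<omega> \<in> cotangent_space IA e" and uv: "u \<in> tangent_space IA e" "v \<in> tangent_space IA e"
      have lin: "linear (\<lambda>u. \<omega> (coord_vector IA (ind c d) e (horizontal (N c d e) u)))"
        using linear_compose[OF linear_horizontal cojet.linear_covector_coords[OF at \<omega>]]
        by (simp add: o_def)
      show "G e (\<lambda>c. a *\<^sub>R u c + b *\<^sub>R v c) \<omega> = a * G e u \<omega> + b * G e v \<omega>"
        using cojet.tangent_space_lincomb[OF uv] uv
        by (simp add: G[OF mem] linear_add[OF lin] linear_scale[OF lin])
    next
      fix v \<omega> \<eta> a b
      assume v: "v \<in> tangent_space IA e"
      then show "G e v (restrict (\<lambda>u. a * \<omega> u + b * \<eta> u) (tangent_space IA e))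
          = a * G e v \<omega> + b * G e v \<eta>"
        by (simp add: G[OF mem] cojet.coord_vector_in_tangent_space[OF at])
    }
  next
    fix k and u w :: "('m, 'n) dual_jet_coords" assume "k \<in> IA"
    then obtain c d where mem: "c \<in> A" "d \<in> B" and k: "k = ind c d"
      unfolding induced_atlas_def by blast
    have open_im: "open (chart_image k)"
      using cojet.open_overlap[OF \<open>k \<in> IA\<close> \<open>k \<in> IA\<close>] by simp
    have comp: "G e (coord_vector IA k e u) (coord_covector IA k e w)
        = fst (snd u) \<bullet> fst (snd w)
          + (\<Sum>j\<in>UNIV. \<Sum>b\<in>UNIV. \<Sum>i\<in>UNIV. (- fst (snd u) $ i * snd (snd w) $ j $ b) *\<^sub>R N c d e j i b)"
      if "e \<in> fst k" for e
    proof -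
      note e = that[unfolded k]
      note at = induced_chart_in_charts_at[OF mem e]
      have "G e (coord_vector IA k e u) (coord_covector IA k e w) = horizontal (N c d e) u \<bullet> w"
        unfolding k G[OF mem e cojet.coord_vector_in_tangent_space[OF at]]
        by (simp only: cojet.coord_covector_coord_vector[OF at at] cojet.coord_vector_chart[OF at]
            cojet.D_self[OF at])
      also have "snd (snd (horizontal (N c d e) u)) \<bullet> snd (snd w) =
          (\<Sum>j\<in>UNIV. \<Sum>b\<in>UNIV. \<Sum>i\<in>UNIV. (- fst (snd u) $ i * snd (snd w) $ j $ b) *\<^sub>R N c d e j i b)"
        by (simp add: horizontal_def inner_vec_def sum_distrib_left sum_distrib_right sum_negf mult_ac)
      then have "horizontal (N c d e) u \<bullet> w = fst (snd u) \<bullet> fst (snd w)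
          + (\<Sum>j\<in>UNIV. \<Sum>b\<in>UNIV. \<Sum>i\<in>UNIV. (- fst (snd u) $ i * snd (snd w) $ j $ b) *\<^sub>R N c d e j i b)"
        by (simp add: inner_prod_def) (simp add: horizontal_def)
      finally show ?thesis .
    qed
    have "smooth_on (chart_image k) (\<lambda>y. N c d (chart_inv k y) j i b)" for j i b
      using N mem by (simp add: spatial_connection_def smooth_in_chart_def k)
    then have "smooth_on (chart_image k) (\<lambda>y. fst (snd u) \<bullet> fst (snd w) +
       (\<Sum>j\<in>UNIV. \<Sum>b\<in>UNIV. \<Sum>i\<in>UNIV. (- fst (snd u) $ i * snd (snd w) $ j $ b) *\<^sub>R
          N c d (chart_inv k y) j i b))"
      by (intro smooth_on_add smooth_on_scaleR smooth_on_sum smooth_on_const open_im finite)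
    then show "smooth_in_chart k (\<lambda>e. G e (coord_vector IA k e u) (coord_covector IA k e w))"
      unfolding smooth_in_chart_def
      by (rule smooth_on_cong[OF open_im, THEN iffD1, rotated])
         (auto simp: chart_inv_induced_chart[OF mem, folded k] comp)
  qed
  then have "spatial_semispray A B G (\<lambda>c d e j i b. 1 / 2 * N c d e j i b)"
    unfolding spatial_semispray_iff using G by simp
  then show ?thesis by (rule exI[of _ G])
qed

end

theorem proposition3p20:
  fixes T :: "'a topology" and A :: "('a, real^'m::finite) chart set"
    and M :: "'b topology" and B :: "('b, real^'n::finite) chart set"
  assumes "smooth_manifold T A" and "smooth_manifold M B"
  shows "(\<forall>G Gc. spatial_semispray A B G Gc \<longrightarrow>
            spatial_connection A B (\<lambda>c d e j i b. 2 * Gc c d e j i b)) \<and>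
         (\<forall>N. spatial_connection A B N \<longrightarrow>
            (\<exists>G. spatial_semispray A B G (\<lambda>c d e j i b. 1 / 2 * N c d e j i b)))"
proof -
  interpret manifold_pair T A M B
    using assms by (rule manifold_pair.intro)
  show ?thesis
    using semispray_components_form_connection connection_gives_semispray by blast
qed

end
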